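(* Let $d\ge3$. There exists $C\in\mathcal{C}^d_{ar}$ with the following properties: (1) $\mu_C$ is singular with respect to $\lambda_d$, has no point masses, and has full support $\mathbb{I}^d$; (2) for $\mu_{C^{1:d-1}}$-almost every $\mathbf{x}\in\mathbb{I}^{d-1}$ the conditional distribution function $y\mapsto K_C(\mathbf{x},[0,y])$ is a strictly increasing step function (i.e. a strictly increasing purely discrete distribution function); (3) there exists a dense countable subset $\mathcal{Q}\subseteq(0,1)$ such that $\mu_C(L_t)>0$ if and only if $t\in\mathcal{Q}$, where $L_t=\{\mathbf{u}\in\mathbb{I}^d:C(\mathbf{u})=t\}$; (4) the Kendall distribution function $F_K^d$ of $C$ is a strictly increasing step function.
   Context: $\mathbb{I}=[0,1]$. $\mathcal{C}^d_{ar}$ is the class of $d$-dimensional Archimedean copulas $C(\mathbf{u})=\psi(\sum_{i=1}^d\varphi(u_i))$, where $\psi:[0,\infty)\to\mathbb{I}$ is continuous, non-increasing, $\psi(0)=1$, $\lim_{z\to\infty}\psi(z)=0$, strictly decreasing on $[0,\inf\{z:\psi(z)=0\}]$, $\psi(1)=1/2$, with $(-1)^{d-2}\psi^{(d-2)}$ existing, non-negative, non-increasing and convex on $(0,\infty)$; $\varphi$ is the pseudo-inverse. $\mu_C$ is the measure of $C$; $C^{1:d-1}(\mathbf{x})=C(\mathbf{x},1)$; $K_C$ is the $(d-1)$-Markov kernel (regular conditional distribution of the last coordinate given the first $d-1$). $F_K^d(t)=\mu_C(\{\mathbf{u}:C(\mathbf{u})\le t\})$ is the Kendall distribution function. *)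

theory Defs
  imports "HOL-Probability.Probability"
begin

text \<open>Points of \<open>\<real>^d\<close> are extensional functions \<open>nat \<Rightarrow> real\<close> on the index set \<open>{..<d}\<close>
  (coordinates \<open>0,\<dots>,d-1\<close>); the last coordinate is \<open>d-1\<close>.\<close>

definition unit_cube :: "nat \<Rightarrow> (nat \<Rightarrow> real) set" where
  "unit_cube d = PiE {..<d} (\<lambda>_. {0..1})"

definition archimedean_generator :: "nat \<Rightarrow> (real \<Rightarrow> real) \<Rightarrow> bool" where
  "archimedean_generator d \<psi> \<longleftrightarrow>
     continuous_on {0..} \<psi> \<and>
     (\<forall>z\<ge>0. 0 \<le> \<psi> z \<and> \<psi> z \<le> 1) \<and>
     monotone_on {0..} (\<le>) (\<ge>) \<psi> \<and>
     \<psi> 0 = 1 \<and>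
     (\<psi> \<longlongrightarrow> 0) at_top \<and>
     \<comment> \<open>strictly decreasing on [0, inf{z. psi z = 0}]\<close>
     (\<forall>x y. 0 \<le> x \<and> x < y \<and> (\<forall>z\<in>{0..<y}. \<psi> z \<noteq> 0) \<longrightarrow> \<psi> y < \<psi> x) \<and>
     \<psi> 1 = 1/2 \<and>
     \<comment> \<open>(-1)^(d-2) psi^(d-2) exists, is non-negative, non-increasing and convex on (0,oo)\<close>
     (\<forall>j < d - 2. \<forall>x>0. (deriv ^^ j) \<psi> differentiable (at x)) \<and>
     (\<forall>x>0. 0 \<le> (-1) ^ (d - 2) * (deriv ^^ (d - 2)) \<psi> x) \<and>
     monotone_on {0<..} (\<le>) (\<ge>) (\<lambda>x. (-1) ^ (d - 2) * (deriv ^^ (d - 2)) \<psi> x) \<and>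
     convex_on {0<..} (\<lambda>x. (-1) ^ (d - 2) * (deriv ^^ (d - 2)) \<psi> x)"

text \<open>Pseudo-inverse \<open>\<phi>(t) = inf{z \<ge> 0. \<psi>(z) = t}\<close> (value \<open>\<infinity>\<close> if the set is empty),
  and \<open>\<psi>\<close> extended by \<open>\<psi>(\<infinity>) = 0\<close>.\<close>

definition pseudo_inv :: "(real \<Rightarrow> real) \<Rightarrow> real \<Rightarrow> ereal" where
  "pseudo_inv \<psi> t = Inf (ereal ` {z. 0 \<le> z \<and> \<psi> z = t})"

definition psi_ext :: "(real \<Rightarrow> real) \<Rightarrow> ereal \<Rightarrow> real" where
  "psi_ext \<psi> e = (if e = \<infinity> then 0 else \<psi> (real_of_ereal e))"

definition arch_copula :: "nat \<Rightarrow> (real \<Rightarrow> real) \<Rightarrow> (nat \<Rightarrow> real) \<Rightarrow> real" where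
  "arch_copula d \<psi> u = psi_ext \<psi> (\<Sum>i<d. pseudo_inv \<psi> (u i))"

definition copula_measure :: "nat \<Rightarrow> ((nat \<Rightarrow> real) \<Rightarrow> real) \<Rightarrow> (nat \<Rightarrow> real) measure \<Rightarrow> bool" where
  "copula_measure d C M \<longleftrightarrow>
     sets M = sets (PiM {..<d} (\<lambda>_. borel)) \<and> prob_space M \<and>
     emeasure M (unit_cube d) = 1 \<and>
     (\<forall>u\<in>unit_cube d. measure M {x\<in>space M. \<forall>i<d. x i \<le> u i} = C u)"

definition lebesgue_d :: "nat \<Rightarrow> (nat \<Rightarrow> real) measure" where
  "lebesgue_d d = PiM {..<d} (\<lambda>_. lborel)"

definition singular_wrt :: "'a measure \<Rightarrow> 'a measure \<Rightarrow> bool" where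
  "singular_wrt M N \<longleftrightarrow> (\<exists>A\<in>sets M. emeasure N A = 0 \<and> emeasure M (space M - A) = 0)"

definition support_d :: "nat \<Rightarrow> (nat \<Rightarrow> real) measure \<Rightarrow> (nat \<Rightarrow> real) set" where
  "support_d d M = {x\<in>space M. \<forall>e>0. emeasure M {y\<in>space M. \<forall>i<d. \<bar>y i - x i\<bar> < e} > 0}"

text \<open>\<open>K\<close> is a (d-1)-Markov kernel of \<open>M = \<mu>_C\<close>: regular conditional distribution of the
  last coordinate given the first \<open>d-1\<close>, with \<open>M1 = \<mu>_{C^{1:d-1}}\<close>.\<close>

definition markov_kernel_of ::
  "nat \<Rightarrow> (nat \<Rightarrow> real) measure \<Rightarrow> (nat \<Rightarrow> real) measure \<Rightarrow> ((nat \<Rightarrow> real) \<Rightarrow> real measure) \<Rightarrow> bool" where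
  "markov_kernel_of d M M1 K \<longleftrightarrow>
     (\<forall>x\<in>space M1. prob_space (K x) \<and> sets (K x) = sets borel) \<and>
     (\<forall>B\<in>sets borel. (\<lambda>x. measure (K x) B) \<in> borel_measurable M1) \<and>
     (\<forall>A\<in>sets M1. \<forall>B\<in>sets borel.
        measure M {u\<in>space M. restrict u {..<d-1} \<in> A \<and> u (d-1) \<in> B}
        = (LINT x:A|M1. measure (K x) B))"

definition strict_step_df :: "(real \<Rightarrow> real) \<Rightarrow> bool" where
  "strict_step_df F \<longleftrightarrow>
     strict_mono_on {0..1} F \<and>
     (\<exists>S p. countable S \<and> S \<subseteq> {0..1} \<and> (\<forall>s\<in>S. 0 \<le> p s) \<and>
        (\<forall>y\<in>{0..1}. (p has_sum F y) (S \<inter> {..y})))"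

definition level_set :: "nat \<Rightarrow> ((nat \<Rightarrow> real) \<Rightarrow> real) \<Rightarrow> real \<Rightarrow> (nat \<Rightarrow> real) set" where
  "level_set d C t = {u\<in>unit_cube d. C u = t}"

definition kendall_df :: "(nat \<Rightarrow> real) measure \<Rightarrow> ((nat \<Rightarrow> real) \<Rightarrow> real) \<Rightarrow> real \<Rightarrow> real" where
  "kendall_df M C t = measure M {u\<in>space M. C u \<le> t}"

end

theory Submission
  imports Defs
begin

text \<open>Write \<open>n = d - 1\<close>. An Archimedean copula is the law of \<open>(\<psi>(R S\<^sub>0), \<dots>, \<psi>(R S\<^sub>n))\<close> with \<open>S\<close>
  uniform on the standard simplex and an independent radius \<open>R > 0\<close>, where
  \<open>\<psi> z = E [max 0 (1 - z / R) ^ n]\<close>. Take \<open>R\<close> discrete with a countable dense set of atoms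
  \<open>r k\<close>. The copula takes the value \<open>\<psi> R\<close> at a sample point, so the mass sits on countably many
  Lebesgue-null level sets and the Kendall distribution is that of \<open>\<psi> R\<close>. Given the first \<open>n\<close>
  coordinates, with \<open>\<phi>\<close>-values adding up to \<open>s\<close>, the last coordinate is \<open>\<psi> (R - s)\<close> for a
  random \<open>R \<ge> s\<close> among the \<open>r k\<close>, hence discrete with dense atoms. Density of the
  radii also gives full support.\<close>

subsection \<open>Mixtures of truncated powers\<close>

text \<open>The weight \<open>w k\<close> is the probability of the radius \<open>r k\<close>
  divided by \<open>r k ^ n\<close>. This turns \<open>\<psi> z\<close> into the series of
  \<open>w k * max 0 (r k - z) ^ n\<close>: no quotient is left, and each differentiation merely
  lowers the exponent. The derivative of order \<open>d - 2 = n - 1\<close> is, up to sign, a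
  positive multiple of the series with exponent 1. That series is convex but has a kink at every
  \<open>r k\<close>, hence on a dense set, and this is the regularity that a generator is allowed
  to have. \<open>summable_weights\<close> asks for more than a finite total probability: one
  majorant has to serve all exponents \<open>m \<le> n\<close>, locally uniformly in
  \<open>z\<close>, and also the plain sum of the \<open>w k\<close>, from which the normalising
  constant of the conditional law is taken. The claim about conditional distributions concerns every
  version of the Markov kernel, so an explicit kernel has to be matched with an arbitrary one up to
  a single null set.\<close>

locale truncated_power_mixture =
  fixes n :: nat and r w :: "nat \<Rightarrow> real"
  assumes n_ge_2: "2 \<le> n"
    and r_pos: "0 < r k"
    and w_pos: "0 < w k"
    and r_dense: "0 \<le> a \<Longrightarrow> a < b \<Longrightarrow> \<exists>k. a < r k \<and> r k < b"
    and summable_weights: "summable (\<lambda>k. w k * (1 + r k) ^ n)"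
begin

definition mixture :: "nat \<Rightarrow> real \<Rightarrow> real" where
  "mixture m z = (\<Sum>k. w k * max 0 (r k - z) ^ m)"

lemma mixture_term_nonneg: "0 \<le> w k * max 0 (r k - z) ^ m"
  using w_pos[of k] by simp

text \<open>The estimate \<open>r k + A \<le> (1 + r k) * (1 + A)\<close> separates \<open>k\<close>
  from \<open>z\<close>. The factor depending on \<open>k\<close> is the one in
  \<open>summable_weights\<close>, so the bound serves as majorant on bounded intervals.\<close>

lemma mixture_term_bound:
  assumes "m \<le> n" "\<bar>z\<bar> \<le> A"
  shows "w k * max 0 (r k - z) ^ m \<le> w k * (1 + r k) ^ n * (1 + A) ^ m"
proof -
  have "max 0 (r k - z) \<le> r k + A" using assms(2) r_pos[of k] by (auto simp: max_def)
  also have "\<dots> \<le> (1 + r k) * (1 + A)"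
    using assms(2) r_pos[of k] by (simp add: algebra_simps)
  finally have "max 0 (r k - z) ^ m \<le> ((1 + r k) * (1 + A)) ^ m"
    by (intro power_mono) auto
  also have "\<dots> = (1 + r k) ^ m * (1 + A) ^ m" by (simp add: power_mult_distrib)
  also have "\<dots> \<le> (1 + r k) ^ n * (1 + A) ^ m"
    using assms r_pos[of k] by (intro mult_right_mono power_increasing) auto
  finally show ?thesis using w_pos[of k] by (simp add: mult.assoc)
qed

lemma summable_mixture: "m \<le> n \<Longrightarrow> summable (\<lambda>k. w k * max 0 (r k - z) ^ m)"
  using mixture_term_bound[of m z "\<bar>z\<bar>"] mixture_term_nonneg[of _ z m]
  by (intro summable_comparison_test'[OF summable_mult2[OF summable_weights, of "(1 + \<bar>z\<bar>) ^ m"]])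
     auto

lemma uniformly_convergent_mixture:
  assumes "m \<le> n"
  shows "uniformly_convergent_on {-A..A} (\<lambda>N z. \<Sum>k<N. w k * max 0 (r k - z) ^ m)"
proof (rule Weierstrass_m_test')
  show "norm (w k * max 0 (r k - z) ^ m) \<le> w k * (1 + r k) ^ n * (1 + A) ^ m"
    if "z \<in> {-A..A}" for k z
    using mixture_term_bound[OF assms, of z A k] mixture_term_nonneg[of k z m] that by auto
  show "summable (\<lambda>k. w k * (1 + r k) ^ n * (1 + A) ^ m)"
    by (rule summable_mult2[OF summable_weights])
qed

text \<open>An exponent of at least 2 makes the left derivative vanish at the kink
  \<open>z = c\<close> too, so the two branches glue along the closed half-lines
  \<open>{..c}\<close> and \<open>{c..}\<close>.\<close>

lemma truncated_power_has_derivative: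
  fixes c z :: real
  assumes "2 \<le> m"
  shows "((\<lambda>z. max 0 (c - z) ^ m) has_real_derivative - real m * max 0 (c - z) ^ (m - 1)) (at z)"
proof -
  have eq: "(\<lambda>z::real. max 0 (c - z) ^ m) = (\<lambda>z. if z \<in> {..c} then (c - z) ^ m else 0)"
    using assms by (auto simp: fun_eq_iff max_def)
  have "((\<lambda>z. if z \<in> {..c} then (c - z) ^ m else 0) has_derivative
        (if z \<in> {..c} then (*) (- real m * (c - z) ^ (m - 1)) else (*) 0)) (at z within {..c} \<union> {c..})"
  proof (rule has_derivative_If_within_closures)
    show "((\<lambda>z. (c - z) ^ m) has_derivative (*) (- real m * (c - z) ^ (m - 1)))
       (at z within {..c} \<union> closure {..c} \<inter> closure {c..})"
      unfolding has_field_derivative_def[symmetric]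
      by (auto intro!: derivative_eq_intros)
  qed (use assms in \<open>auto simp: fun_eq_iff max_def\<close>)
  moreover have "{..c} \<union> {c..} = UNIV" by auto
  ultimately show ?thesis
    unfolding eq has_field_derivative_def using assms
    by (auto simp: max_def mult_commute_abs power_0_left split: if_splits)
qed

lemma mixture_has_derivative:
  assumes "2 \<le> m" "m \<le> n"
  shows "(mixture m has_real_derivative - real m * mixture (m - 1) z) (at z)"
proof -
  define S where "S = {-(\<bar>z\<bar> + 1)..\<bar>z\<bar> + 1}"
  have z: "z \<in> interior S" by (auto simp: S_def interior_atLeastAtMost_real)
  have "((\<lambda>x. \<Sum>k. w k * max 0 (r k - x) ^ m) has_field_derivative
      (\<Sum>k. w k * (- real m * max 0 (r k - z) ^ (m - 1)))) (at z)"
  proof (rule has_field_derivative_series'(2)[where S = S and x0 = z])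
    show "((\<lambda>x. w k * max 0 (r k - x) ^ m) has_field_derivative
        w k * (- real m * max 0 (r k - x) ^ (m - 1))) (at x within S)" for k x
      using DERIV_cmult[OF truncated_power_has_derivative[OF assms(1)]]
      by (rule has_field_derivative_at_within)
    have "uniformly_convergent_on S (\<lambda>N x. - real m * (\<Sum>k<N. w k * max 0 (r k - x) ^ (m - 1)))"
      unfolding S_def using assms
      by (intro uniformly_convergent_mult uniformly_convergent_mixture) auto
    then show "uniformly_convergent_on S (\<lambda>N x. \<Sum>k<N. w k * (- real m * max 0 (r k - x) ^ (m - 1)))"
      by (simp add: sum_distrib_left mult_ac)
    show "summable (\<lambda>k. w k * max 0 (r k - z) ^ m)"
      using assms by (intro summable_mixture)
  qed (use z interior_subset in \<open>auto simp: S_def\<close>)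
  also have "(\<Sum>k. w k * (- real m * max 0 (r k - z) ^ (m - 1))) = - real m * mixture (m - 1) z"
    unfolding mixture_def using summable_mixture[of "m - 1" z] assms
    by (subst suminf_mult[symmetric]) (auto simp: mult_ac)
  finally show ?thesis by (simp add: mixture_def[abs_def])
qed

lemma continuous_mixture: "2 \<le> m \<Longrightarrow> m \<le> n \<Longrightarrow> continuous_on S (mixture m)"
  using mixture_has_derivative DERIV_isCont by (blast intro: continuous_at_imp_continuous_on)

lemma mixture_antimono: "m \<le> n \<Longrightarrow> x \<le> y \<Longrightarrow> mixture m y \<le> mixture m x"
  unfolding mixture_def using less_imp_le[OF w_pos]
  by (intro suminf_le summable_mixture mult_left_mono power_mono) auto

lemma mixture_nonneg: "m \<le> n \<Longrightarrow> 0 \<le> mixture m z"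
  unfolding mixture_def by (intro suminf_nonneg summable_mixture mixture_term_nonneg)

text \<open>Density gives a radius between \<open>max 0 x\<close> and \<open>y\<close>. Its term is
  positive at \<open>x\<close> and zero at \<open>y\<close>, while no other term is larger at
  \<open>y\<close>.\<close>

lemma mixture_strict_antimono:
  assumes "1 \<le> m" "m \<le> n" "x < y" "0 < y"
  shows "mixture m y < mixture m x"
proof -
  obtain k where k: "max 0 x < r k" "r k < y"
    using r_dense[of "max 0 x" y] assms by auto
  have "0 < (\<Sum>k. w k * max 0 (r k - x) ^ m - w k * max 0 (r k - y) ^ m)"
  proof (rule suminf_pos2)
    show "summable (\<lambda>k. w k * max 0 (r k - x) ^ m - w k * max 0 (r k - y) ^ m)"
      using assms by (intro summable_diff summable_mixture)
    show "0 \<le> w k * max 0 (r k - x) ^ m - w k * max 0 (r k - y) ^ m" for k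
      using assms less_imp_le[OF w_pos[of k]] by (auto intro!: mult_left_mono power_mono)
    show "0 < w k * max 0 (r k - x) ^ m - w k * max 0 (r k - y) ^ m"
    proof -
      have "max 0 (r k - y) = 0" "0 < max 0 (r k - x)" using k by (auto simp: max_def split: if_splits)
      then show ?thesis using assms w_pos[of k] by (simp add: power_0_left)
    qed
  qed
  then show ?thesis
    unfolding mixture_def using assms by (simp add: suminf_diff[OF summable_mixture summable_mixture, symmetric])
qed

lemma mixture_pos: "1 \<le> m \<Longrightarrow> m \<le> n \<Longrightarrow> 0 < mixture m z"
  using mixture_strict_antimono[of m z "max z 0 + 1"] mixture_nonneg[of m "max z 0 + 1"]
  by linarith

text \<open>Tannery's theorem: each term vanishes once \<open>z\<close> passes \<open>r k\<close>,
  and for \<open>z \<ge> 0\<close> it is dominated by its value at 0.\<close>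

lemma mixture_tendsto_0:
  assumes "1 \<le> m" "m \<le> n"
  shows "(mixture m \<longlongrightarrow> 0) at_top"
proof -
  have "((\<lambda>z. \<Sum>k. w k * max 0 (r k - z) ^ m) \<longlongrightarrow> (\<Sum>k::nat. 0::real)) at_top"
  proof (rule tannerys_theorem[THEN conjunct2, THEN conjunct2])
    show "((\<lambda>z. w k * max 0 (r k - z) ^ m) \<longlongrightarrow> 0) at_top" for k
      using assms by (intro tendsto_eventually eventually_at_top_linorderI[of "r k"]) (auto simp: max_def)
    have "norm (w k * max 0 (r k - z) ^ m) \<le> w k * (1 + r k) ^ n" if "0 \<le> z" for k z
    proof -
      have "w k * max 0 (r k - z) ^ m \<le> w k * max 0 (r k - 0) ^ m"
        using that less_imp_le[OF w_pos[of k]] by (intro mult_left_mono power_mono) auto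
      also have "\<dots> \<le> w k * (1 + r k) ^ n"
        using mixture_term_bound[OF assms(2), of 0 0 k] by simp
      finally show ?thesis using mixture_term_nonneg[of k z m] by simp
    qed
    then have "eventually (\<lambda>z. \<forall>k. norm (w k * max 0 (r k - z) ^ m) \<le> w k * (1 + r k) ^ n) at_top"
      by (intro eventually_at_top_linorderI[of 0]) blast
    from eventually_prodI[OF eventually_True this, of sequentially]
    show "eventually (\<lambda>(k, z). norm (w k * max 0 (r k - z) ^ m) \<le> w k * (1 + r k) ^ n)
        (at_top \<times>\<^sub>F at_top)"
      by (rule eventually_mono) (simp add: case_prod_beta)
  qed (use summable_weights in auto)
  then show ?thesis by (simp add: mixture_def[abs_def])
qed

text \<open>Each term is a positive multiple of the maximum of 0 and an affine function. Exponent 1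
  is out of reach of \<open>mixture_has_derivative\<close>, so convexity is taken from the terms and
  not from a second derivative.\<close>

lemma convex_mixture_1: "convex_on S (mixture 1)" if "convex S"
proof (rule convex_onI)
  fix t x y :: real assume t: "0 < t" "t < 1"
  have n: "1 \<le> n" using n_ge_2 by simp
  note sm = summable_mixture[OF n]
  have "mixture 1 ((1 - t) *\<^sub>R x + t *\<^sub>R y) \<le>
    (\<Sum>k. (1 - t) * (w k * max 0 (r k - x) ^ 1) + t * (w k * max 0 (r k - y) ^ 1))"
    unfolding mixture_def
  proof (intro suminf_le sm summable_add summable_mult)
    fix k
    have "r k - ((1 - t) * x + t * y) = (1 - t) * (r k - x) + t * (r k - y)"
      by (simp add: algebra_simps)
    also have "\<dots> \<le> (1 - t) * max 0 (r k - x) + t * max 0 (r k - y)"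
      using t by (intro add_mono mult_left_mono) auto
    finally have "max 0 (r k - ((1 - t) * x + t * y)) \<le> (1 - t) * max 0 (r k - x) + t * max 0 (r k - y)"
      using t by simp
    from mult_left_mono[OF this less_imp_le[OF w_pos[of k]]]
    show "w k * max 0 (r k - ((1 - t) *\<^sub>R x + t *\<^sub>R y)) ^ 1 \<le>
       (1 - t) * (w k * max 0 (r k - x) ^ 1) + t * (w k * max 0 (r k - y) ^ 1)"
      by (simp add: algebra_simps)
  qed
  also have "\<dots> = (1 - t) * mixture 1 x + t * mixture 1 y"
    unfolding mixture_def using sm
    by (subst suminf_add[symmetric]) (auto intro!: summable_mult simp: suminf_mult)
  finally show "mixture 1 ((1 - t) *\<^sub>R x + t *\<^sub>R y) \<le> (1 - t) * mixture 1 x + t * mixture 1 y" .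
qed (fact that)

text \<open>The constant \<open>c\<close> is the falling factorial of \<open>n\<close> of length
  \<open>j\<close>; only its sign matters later. Each differentiation starts from an exponent of at
  least 2, so the iteration ends at exponent 1, whence \<open>j < n\<close>.\<close>

lemma deriv_iterate_mixture:
  "j < n \<Longrightarrow> \<exists>c>0. (deriv ^^ j) (mixture n) = (\<lambda>z. (-1) ^ j * c * mixture (n - j) z)"
proof (induction j)
  case (Suc j)
  then obtain c where c: "c > 0"
    and eq: "(deriv ^^ j) (mixture n) = (\<lambda>z. (-1) ^ j * c * mixture (n - j) z)" by auto
  have "deriv (\<lambda>z. (-1) ^ j * c * mixture (n - j) z) z
      = (-1) ^ j * c * (- real (n - j) * mixture (n - j - 1) z)" for z
    using Suc.prems by (intro DERIV_imp_deriv DERIV_cmult mixture_has_derivative) auto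
  then have "(deriv ^^ Suc j) (mixture n) = (\<lambda>z. (-1) ^ Suc j * (c * real (n - j)) * mixture (n - Suc j) z)"
    by (simp add: eq fun_eq_iff mult.assoc)
  then show ?case using c Suc.prems by (intro exI[of _ "c * real (n - j)"]) auto
qed (auto intro: exI[of _ 1])

lemma differentiable_deriv_iterate_mixture:
  assumes "j < n - 1"
  shows "(deriv ^^ j) (mixture n) differentiable (at z)"
proof -
  obtain c where eq: "(deriv ^^ j) (mixture n) = (\<lambda>z. (-1) ^ j * c * mixture (n - j) z)"
    using deriv_iterate_mixture[of j] assms by fastforce
  have "((\<lambda>z. (-1) ^ j * c * mixture (n - j) z) has_real_derivative
      (-1) ^ j * c * (- real (n - j) * mixture (n - j - 1) z)) (at z)"
    using assms by (intro DERIV_cmult mixture_has_derivative) auto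
  then show ?thesis unfolding eq real_differentiable_def by blast
qed

lemma archimedean_generator_mixture:
  assumes "mixture n 0 = 1" "mixture n 1 = 1 / 2"
  shows "archimedean_generator (Suc n) (mixture n)"
proof -
  have n1: "1 \<le> n" using n_ge_2 by simp
  obtain c where c: "c > 0"
    and deriv: "(deriv ^^ (n - 1)) (mixture n) = (\<lambda>z. (-1) ^ (n - 1) * c * mixture 1 z)"
    using deriv_iterate_mixture[of "n - 1"] n1 by auto
  have eq: "(\<lambda>z. (-1) ^ (n - 1) * (deriv ^^ (n - 1)) (mixture n) z) = (\<lambda>z. c * mixture 1 z)"
    unfolding deriv by (simp add: mult.assoc[symmetric] power_mult_distrib[symmetric])
  show ?thesis
    unfolding archimedean_generator_def
  proof (intro conjI)
    show "\<forall>z\<ge>0. 0 \<le> mixture n z \<and> mixture n z \<le> 1"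
      using mixture_nonneg mixture_antimono[of n 0] assms by auto
    show "\<forall>x y. 0 \<le> x \<and> x < y \<and> (\<forall>z\<in>{0..<y}. mixture n z \<noteq> 0) \<longrightarrow> mixture n y < mixture n x"
      using mixture_strict_antimono n1 by auto
    show "\<forall>j<Suc n - 2. \<forall>x>0. (deriv ^^ j) (mixture n) differentiable (at x)"
      using differentiable_deriv_iterate_mixture by auto
    have s: "Suc n - 2 = n - 1" by simp
    show "\<forall>x>0. 0 \<le> (- 1) ^ (Suc n - 2) * (deriv ^^ (Suc n - 2)) (mixture n) x"
      unfolding s using fun_cong[OF eq] c mixture_nonneg[of 1] n1 by simp
    show "monotone_on {0<..} (\<le>) (\<ge>) (\<lambda>x. (- 1) ^ (Suc n - 2) * (deriv ^^ (Suc n - 2)) (mixture n) x)"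
      unfolding s eq using c n1 mixture_antimono[of 1] by (auto intro!: monotone_onI)
    show "convex_on {0<..} (\<lambda>x. (- 1) ^ (Suc n - 2) * (deriv ^^ (Suc n - 2)) (mixture n) x)"
      unfolding s eq using c by (intro convex_on_cmul convex_mixture_1) auto
  qed (use assms n_ge_2 n1 mixture_antimono mixture_tendsto_0 in
      \<open>auto intro!: continuous_mixture monotone_onI\<close>)
qed

end

subsection \<open>Measure-theoretic preliminaries\<close>

lemma distr_PiM_lborel_translate:
  fixes a :: "'i \<Rightarrow> real"
  assumes "finite I"
  shows "distr (PiM I (\<lambda>_. lborel)) (PiM I (\<lambda>_. lborel)) (\<lambda>x. \<lambda>i\<in>I. x i + a i) = PiM I (\<lambda>_. lborel)"
    (is "distr ?L ?L ?f = ?L")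
proof -
  interpret product_sigma_finite "\<lambda>_::'i. lborel :: real measure" by standard
  have f [measurable]: "?f \<in> ?L \<rightarrow>\<^sub>M ?L" by measurable
  show ?thesis
  proof (rule PiM_eqI[OF assms])
    fix A :: "'i \<Rightarrow> real set" assume A: "\<And>i. i \<in> I \<Longrightarrow> A i \<in> sets lborel"
    then have shift: "(\<lambda>t. t + a i) -` A i \<in> sets borel" if "i \<in> I" for i
      using measurable_sets[of "\<lambda>t. t + a i" borel borel "A i"] that by simp
    have "emeasure (distr ?L ?L ?f) (PiE I A) = emeasure ?L (?f -` PiE I A \<inter> space ?L)"
      using A assms by (intro emeasure_distr) auto
    also have "?f -` PiE I A \<inter> space ?L = PiE I (\<lambda>i. (\<lambda>t. t + a i) -` A i)"
      by (auto simp: space_PiM PiE_iff)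
    also have "emeasure ?L \<dots> = (\<Prod>i\<in>I. emeasure lborel ((\<lambda>t. t + a i) -` A i))"
      by (rule emeasure_PiM[OF assms]) (simp add: shift)
    also have "\<dots> = (\<Prod>i\<in>I. emeasure lborel (A i))"
    proof (rule prod.cong)
      fix i assume "i \<in> I"
      then have "emeasure (distr lborel borel ((+) (a i))) (A i) = emeasure lborel ((\<lambda>t. t + a i) -` A i)"
        using A \<open>i \<in> I\<close> by (subst emeasure_distr) (auto simp: add.commute[of "a i"] vimage_def)
      then show "emeasure lborel ((\<lambda>t. t + a i) -` A i) = emeasure lborel (A i)"
        by (simp add: lborel_distr_plus)
    qed simp
    finally show "emeasure (distr ?L ?L ?f) (PiE I A) = (\<Prod>i\<in>I. emeasure lborel (A i))" .
  qed simp
qed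

text \<open>Translation by \<open>a\<close> carries the region to a standard simplex of size
  \<open>t - sum a I\<close>. Its volume is the source of the truncated power in the generator; a
  nonempty \<open>I\<close> makes the power 0 when \<open>t < sum a I\<close>.\<close>

lemma emeasure_translated_simplex:
  fixes a :: "'i \<Rightarrow> real"
  assumes "finite I" "I \<noteq> {}"
  shows "emeasure (PiM I (\<lambda>_. lborel))
     {x \<in> space (PiM I (\<lambda>_. lborel)). (\<forall>i\<in>I. a i \<le> x i) \<and> sum x I \<le> t} =
     ennreal (max 0 (t - sum a I) ^ card I / fact (card I))" (is "emeasure ?L ?S = _")
proof (cases "sum a I \<le> t")
  case True
  have [measurable]: "?S \<in> sets ?L" using assms(1) by measurable
  have "emeasure ?L ?S = emeasure (distr ?L ?L (\<lambda>x. \<lambda>i\<in>I. x i + a i)) ?S"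
    by (simp add: distr_PiM_lborel_translate[OF assms(1)])
  also have "\<dots> = emeasure ?L ((\<lambda>x. \<lambda>i\<in>I. x i + a i) -` ?S \<inter> space ?L)"
    by (rule emeasure_distr) measurable
  also have "(\<lambda>x. \<lambda>i\<in>I. x i + a i) -` ?S \<inter> space ?L =
      {x. (\<forall>i\<in>I. 0 \<le> x i) \<and> sum x I \<le> t - sum a I} \<inter> space ?L"
    by (auto simp: space_PiM sum.distrib algebra_simps)
  also have "emeasure ?L \<dots> = ennreal ((t - sum a I) ^ card I / fact (card I))"
    using True assms(1) by (subst emeasure_std_simplex_aux) (auto simp: divide_ennreal ennreal_power)
  finally show ?thesis using True by simp
next
  case False
  have "?S = {}" using False sum_mono[of I a] by fastforce
  then have "emeasure ?L ?S = 0" by (simp only: emeasure_empty)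
  then show ?thesis using False assms by (simp add: max_def card_gt_0_iff power_0_left)
qed

text \<open>Countable additivity in the form that \<open>strict_step_df\<close> asks for, obtained
  through integration against the counting measure.\<close>

lemma has_sum_measure_singletons:
  assumes "finite_measure N" "countable X" "\<And>x. x \<in> X \<Longrightarrow> {x} \<in> sets N"
  shows "((\<lambda>x. measure N {x}) has_sum measure N X) X"
proof -
  interpret finite_measure N by fact
  have "(\<integral>\<^sup>+x. ennreal (measure N {x}) \<partial>count_space X) = emeasure N X"
    using emeasure_countable_singleton[of X N] assms(2,3) by (simp add: emeasure_eq_measure)
  then have "has_bochner_integral (count_space X) (\<lambda>x. measure N {x}) (measure N X)"
    by (intro has_bochner_integral_nn_integral) (auto simp: emeasure_eq_measure)
  then have "Infinite_Set_Sum.abs_summable_on (\<lambda>x. measure N {x}) X" "infsetsum (\<lambda>x. measure N {x}) X = measure N X"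
    by (auto simp: Infinite_Set_Sum.abs_summable_on_def infsetsum_def has_bochner_integral_iff)
  then show ?thesis
    by (metis abs_summable_equivalent abs_summable_summable has_sum_infsum infsetsum_infsum)
qed

text \<open>Common criterion for the conditional laws and the Kendall distribution: a countable
  carrier makes the function the sum of its jumps, and an atom above \<open>a\<close> and at most
  \<open>b\<close> makes it increase strictly from \<open>a\<close> to \<open>b\<close>.\<close>

lemma strict_step_df_discrete:
  assumes N: "finite_measure N" "sets N = sets borel"
    and S: "countable S" "S \<subseteq> {0..1}" "emeasure N (- S) = 0"
    and atoms: "\<And>a b. 0 \<le> a \<Longrightarrow> a < b \<Longrightarrow> b \<le> 1 \<Longrightarrow> \<exists>s. a < s \<and> s \<le> b \<and> 0 < measure N {s}"
  shows "strict_step_df (\<lambda>y. measure N {0..y})"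
proof -
  interpret finite_measure N by fact
  have [measurable_cong]: "sets N = sets borel" by fact
  have S_meas [measurable]: "S \<in> sets borel" using S(1) by (rule sets.countable[rotated]) auto
  have "((\<lambda>s. measure N {s}) has_sum measure N {0..y}) (S \<inter> {..y})" for y
  proof -
    have "AE x in N. x \<in> S"
    proof (rule AE_I')
      show "- S \<in> null_sets N"
        using S(3) S_meas by (intro null_setsI) (simp_all add: N(2))
    qed blast
    then have "AE x in N. x \<in> {0..y} \<longleftrightarrow> x \<in> S \<inter> {..y}"
      by (rule eventually_mono) (use S(2) in auto)
    then have "measure N {0..y} = measure N (S \<inter> {..y})"
      by (rule finite_measure_eq_AE) measurable
    then show ?thesis
      using has_sum_measure_singletons[of N "S \<inter> {..y}"] N S(1) by auto
  qed
  moreover have "strict_mono_on {0..1} (\<lambda>y. measure N {0..y})"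
  proof (rule strict_mono_onI)
    fix a b :: real assume ab: "a \<in> {0..1}" "b \<in> {0..1}" "a < b"
    then obtain s where s: "a < s" "s \<le> b" "0 < measure N {s}" using atoms[of a b] by auto
    have "measure N {0..a} < measure N {0..a} + measure N {s}" using s by simp
    also have "\<dots> = measure N ({0..a} \<union> {s})"
      using s N(2) by (intro finite_measure_Union[symmetric]) auto
    also have "\<dots> \<le> measure N {0..b}"
      using s ab N(2) by (intro finite_measure_mono) auto
    finally show "measure N {0..a} < measure N {0..b}" .
  qed
  ultimately show ?thesis
    unfolding strict_step_df_def using S by (intro conjI exI[of _ S] exI[of _ "\<lambda>s. measure N {s}"]) auto
qed

text \<open>Right continuity recovers a distribution function from its rational values. Only
  countably many test sets occur, which lets null sets be merged when two kernels are
  compared.\<close>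

lemma real_distribution_eq_rational:
  assumes "real_distribution N" "real_distribution N'"
    and eq: "\<And>q. q \<in> \<rat> \<Longrightarrow> measure N {..q} = measure N' {..q}"
  shows "N = N'"
proof (rule cdf_unique[OF assms(1,2) ext])
  have le: "cdf N1 y \<le> cdf N2 y"
    if N: "real_distribution N1" "real_distribution N2"
      and eq: "\<And>q. q \<in> \<rat> \<Longrightarrow> measure N1 {..q} = measure N2 {..q}" for N1 N2 y
  proof (rule tendsto_lowerbound)
    interpret N1: real_distribution N1 by fact
    interpret N2: real_distribution N2 by fact
    show "(cdf N2 \<longlongrightarrow> cdf N2 y) (at_right y)"
      using N2.cdf_is_right_cont by (simp add: continuous_within)
    show "eventually (\<lambda>z. cdf N1 y \<le> cdf N2 z) (at_right y)"
      unfolding eventually_at_right_field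
    proof (intro exI[of _ "y + 1"] conjI allI impI)
      fix z assume "y < z"
      then obtain q where q: "q \<in> \<rat>" "y < q" "q < z" using Rats_dense_in_real by blast
      have "cdf N1 y \<le> cdf N1 q" using q by (intro N1.cdf_nondecreasing) simp
      also have "\<dots> = cdf N2 q" using eq[OF q(1)] by (simp add: cdf_def)
      also have "\<dots> \<le> cdf N2 z" using q by (intro N2.cdf_nondecreasing) simp
      finally show "cdf N1 y \<le> cdf N2 z" .
    qed simp
  qed simp
  show "cdf N y = cdf N' y" for y
    using le[OF assms(1,2)] le[OF assms(2,1)] eq by (intro antisym) auto
qed

subsection \<open>The copula measure\<close>

text \<open>\<open>mixture_0\<close> says that the probabilities \<open>w k * r k ^ n\<close> add up
  to 1; \<open>mixture_1\<close> fixes the scale, as required of a generator.\<close>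

locale archimedean_mixture = truncated_power_mixture +
  assumes mixture_0: "mixture n 0 = 1" and mixture_1: "mixture n 1 = 1 / 2"
begin

abbreviation \<psi> :: "real \<Rightarrow> real" where "\<psi> \<equiv> mixture n"

lemma n_ge_1: "1 \<le> n" using n_ge_2 by simp

lemma psi_less_iff: "0 \<le> x \<Longrightarrow> 0 \<le> y \<Longrightarrow> \<psi> x < \<psi> y \<longleftrightarrow> y < x"
  using mixture_strict_antimono[of n y x] mixture_antimono[of n x y] n_ge_1 by force

lemma psi_le_iff: "0 \<le> x \<Longrightarrow> 0 \<le> y \<Longrightarrow> \<psi> x \<le> \<psi> y \<longleftrightarrow> y \<le> x"
  using psi_less_iff[of y x] by linarith

lemma psi_eq_iff: "0 \<le> x \<Longrightarrow> 0 \<le> y \<Longrightarrow> \<psi> x = \<psi> y \<longleftrightarrow> x = y"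
  using psi_le_iff[of y x] psi_le_iff[of x y] by linarith

lemma psi_pos: "0 < \<psi> z"
  using mixture_pos n_ge_1 by simp

lemma psi_le_1: "0 \<le> z \<Longrightarrow> \<psi> z \<le> 1"
  using psi_le_iff[of z 0] mixture_0 by simp

lemma psi_less_1: "0 < z \<Longrightarrow> \<psi> z < 1"
  using psi_less_iff[of z 0] mixture_0 by simp

lemma psi_continuous: "continuous_on S \<psi>"
  using continuous_mixture n_ge_2 by simp

lemma psi_measurable [measurable]: "\<psi> \<in> borel_measurable borel"
  by (intro borel_measurable_continuous_onI psi_continuous)

lemma psi_surj:
  assumes "0 < t" "t \<le> 1"
  shows "\<exists>z\<ge>0. \<psi> z = t"
proof -
  have "eventually (\<lambda>z. \<psi> z < t) at_top"
    using mixture_tendsto_0[of n] n_ge_1 assms by (intro order_tendstoD(2)) auto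
  then have "eventually (\<lambda>z. \<psi> z < t \<and> 0 \<le> z) at_top"
    by (intro eventually_conj eventually_ge_at_top)
  from eventually_happens[OF this] obtain b where "\<psi> b < t" "0 \<le> b" by auto
  then obtain z where "0 \<le> z" "\<psi> z = t"
    using IVT2'[of \<psi> b t 0] psi_continuous mixture_0 assms by auto
  then show ?thesis by blast
qed

lemma pseudo_inv_psi: "0 \<le> z \<Longrightarrow> pseudo_inv \<psi> (\<psi> z) = ereal z"
proof -
  assume "0 \<le> z"
  then have "{z'. 0 \<le> z' \<and> \<psi> z' = \<psi> z} = {z}" using psi_eq_iff by auto
  then show ?thesis by (simp add: pseudo_inv_def)
qed

text \<open>\<open>\<psi>\<close> never vanishes, since arbitrarily large radii occur. So 0 has no
  preimage either, and the infimum of the empty set is \<open>\<infinity>\<close>.\<close>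

lemma pseudo_inv_outside: "t \<notin> {0<..1} \<Longrightarrow> pseudo_inv \<psi> t = \<infinity>"
proof -
  assume "t \<notin> {0<..1}"
  then have "{z. 0 \<le> z \<and> \<psi> z = t} = {}" using psi_pos psi_le_1 by auto
  then show ?thesis unfolding pseudo_inv_def by (simp only: image_empty Inf_empty top_ereal_def)
qed

lemma pseudo_inv_cases:
  obtains (finite) z where "0 \<le> z" "t = \<psi> z" "pseudo_inv \<psi> t = ereal z"
  | (infinite) "t \<notin> {0<..1}" "pseudo_inv \<psi> t = \<infinity>"
proof (cases "t \<in> {0<..1}")
  case True
  then obtain z where "0 \<le> z" "\<psi> z = t" using psi_surj[of t] by auto
  then show ?thesis using pseudo_inv_psi[of z] by (intro finite[of z]) simp_all
next
  case False
  then show ?thesis by (intro infinite pseudo_inv_outside)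
qed

lemma pseudo_inv_nonneg: "0 \<le> pseudo_inv \<psi> t"
  by (cases t rule: pseudo_inv_cases) auto

lemma pseudo_inv_eq_ereal_iff: "pseudo_inv \<psi> t = ereal z \<longleftrightarrow> 0 \<le> z \<and> t = \<psi> z"
  by (cases t rule: pseudo_inv_cases) (auto simp: psi_eq_iff pseudo_inv_psi)

lemma pseudo_inv_measurable [measurable]: "pseudo_inv \<psi> \<in> borel_measurable borel"
proof (rule borel_measurableI_less)
  fix y :: ereal
  consider "y \<le> 0" | "y = \<infinity>" | z where "0 < z" "y = ereal z" by (cases y) force+
  then have "{t. pseudo_inv \<psi> t < y} \<in> sets borel"
  proof cases
    case 1
    have "\<not> pseudo_inv \<psi> t < y" for t
      using order_trans[OF 1 pseudo_inv_nonneg[of t]] by (simp add: not_less)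
    then have "{t. pseudo_inv \<psi> t < y} = {}" by blast
    then show ?thesis by (simp only: sets.empty_sets)
  next
    case 2
    have "t \<in> {t. pseudo_inv \<psi> t < y} \<longleftrightarrow> t \<in> {0<..1}" for t
      using 2 by (cases t rule: pseudo_inv_cases) (auto simp: psi_pos psi_le_1)
    then have "{t. pseudo_inv \<psi> t < y} = {0<..1}" by (rule set_eqI)
    then show ?thesis by simp
  next
    case 3
    have "t \<in> {t. pseudo_inv \<psi> t < y} \<longleftrightarrow> t \<in> {\<psi> z<..1}" for t
      using 3 less_trans[OF psi_pos[of z], of t]
      by (cases t rule: pseudo_inv_cases) (auto simp: psi_pos psi_le_1 psi_less_iff)
    then have "{t. pseudo_inv \<psi> t < y} = {\<psi> z<..1}" by (rule set_eqI)
    then show ?thesis by simp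
  qed
  then show "{t \<in> space borel. pseudo_inv \<psi> t < y} \<in> sets borel" by simp
qed

lemma psi_ext_eq_iff:
  assumes "0 \<le> e" "0 \<le> z"
  shows "psi_ext \<psi> e = \<psi> z \<longleftrightarrow> e = ereal z"
  using assms psi_pos[of z] by (cases e) (auto simp: psi_ext_def psi_eq_iff)

abbreviation copula :: "(nat \<Rightarrow> real) \<Rightarrow> real" where
  "copula \<equiv> arch_copula (Suc n) \<psi>"

lemma sum_pseudo_inv_nonneg: "0 \<le> (\<Sum>i\<in>I. pseudo_inv \<psi> (u i))"
  by (intro sum_nonneg pseudo_inv_nonneg)

lemma sum_pseudo_inv_psi:
  "(\<And>i. i \<in> I \<Longrightarrow> 0 \<le> z i) \<Longrightarrow> (\<Sum>i\<in>I. pseudo_inv \<psi> (\<psi> (z i))) = ereal (\<Sum>i\<in>I. z i)"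
  by (simp add: pseudo_inv_psi)

lemma copula_eq_iff: "0 \<le> z \<Longrightarrow> copula u = \<psi> z \<longleftrightarrow> (\<Sum>i<Suc n. pseudo_inv \<psi> (u i)) = ereal z"
  unfolding arch_copula_def by (intro psi_ext_eq_iff sum_pseudo_inv_nonneg)

lemma copula_measurable [measurable]: "copula \<in> borel_measurable (PiM {..<Suc n} (\<lambda>_. borel))"
  unfolding arch_copula_def[abs_def] psi_ext_def[abs_def] by measurable

section \<open>The law built from uniform distributions on simplices, and its distribution
  function\<close>

abbreviation (input) L :: "(nat \<Rightarrow> real) measure" where "L \<equiv> PiM {..<n} (\<lambda>_. lborel)"

text \<open>The bound on the sum expresses that the omitted last coordinate
  \<open>t - (\<Sum>j<n. v j)\<close> is nonnegative.\<close>

definition solid_simplex :: "real \<Rightarrow> (nat \<Rightarrow> real) set" where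
  "solid_simplex t = {v \<in> space L. (\<forall>i<n. 0 \<le> v i) \<and> (\<Sum>i<n. v i) \<le> t}"

definition simplex_point :: "real \<Rightarrow> (nat \<Rightarrow> real) \<Rightarrow> nat \<Rightarrow> real" where
  "simplex_point t v = (\<lambda>i\<in>{..<Suc n}. \<psi> (if i < n then v i else t - (\<Sum>j<n. v j)))"

text \<open>Given the radius \<open>r k\<close>, chosen with probability \<open>w k * r k ^ n\<close>, the vector
  \<open>(\<phi>(U\<^sub>0), \<dots>, \<phi>(U\<^sub>n))\<close> is uniform on the simplex \<open>x\<^sub>0 + \<dots> + x\<^sub>n = r k\<close>, whose
  projection to the first \<open>n\<close> coordinates has volume \<open>r k ^ n / fact n\<close>.\<close>

definition mass :: "(nat \<Rightarrow> real) measure" where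
  "mass = distr
     (density (count_space UNIV \<Otimes>\<^sub>M L)
       (\<lambda>(k, v). ennreal (fact n * w k) * indicator (solid_simplex (r k)) v))
     (PiM {..<Suc n} (\<lambda>_. borel)) (\<lambda>(k, v). simplex_point (r k) v)"

lemma solid_simplex_measurable [measurable]: "solid_simplex t \<in> sets L"
  unfolding solid_simplex_def by measurable

lemma simplex_point_measurable [measurable]:
  "simplex_point t \<in> L \<rightarrow>\<^sub>M PiM {..<Suc n} (\<lambda>_. borel)"
  unfolding simplex_point_def[abs_def]
proof (rule measurable_restrict)
  show "(\<lambda>v. \<psi> (if i < n then v i else t - (\<Sum>j<n. v j))) \<in> borel_measurable L" for i
  proof (cases "i < n")
    case True
    then have "(\<lambda>v. v i) \<in> borel_measurable L"
      using measurable_component_singleton[of i "{..<n}" "\<lambda>_. lborel"] by simp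
    then show ?thesis using True by simp
  qed simp
qed

lemma mass_density_measurable [measurable]:
  "(\<lambda>(k, v). ennreal (fact n * w k) * indicator (solid_simplex (r k)) v)
     \<in> borel_measurable (count_space UNIV \<Otimes>\<^sub>M L)"
  by (rule measurable_pair_measure_countable1) auto

lemma mass_map_measurable [measurable]:
  "(\<lambda>(k, v). simplex_point (r k) v) \<in> count_space UNIV \<Otimes>\<^sub>M L \<rightarrow>\<^sub>M PiM {..<Suc n} (\<lambda>_. borel)"
  by (rule measurable_pair_measure_countable1) auto

lemma sets_mass [measurable_cong, simp]: "sets mass = sets (PiM {..<Suc n} (\<lambda>_. borel))"
  by (simp add: mass_def)

lemma space_mass: "space mass = PiE {..<Suc n} (\<lambda>_. UNIV)"
  by (simp add: mass_def space_PiM)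

lemma sigma_finite_L: "sigma_finite_measure L"
proof -
  interpret product_sigma_finite "\<lambda>_::nat. lborel :: real measure" by standard
  show ?thesis by (rule sigma_finite) simp
qed

text \<open>The density \<open>fact n * w k\<close> is the probability \<open>w k * r k ^ n\<close>
  divided by the volume \<open>r k ^ n / fact n\<close> of the solid simplex, so no power of
  \<open>r k\<close> remains. Tonelli then splits the integral over the radii.\<close>

lemma nn_integral_mass:
  assumes [measurable]: "f \<in> borel_measurable (PiM {..<Suc n} (\<lambda>_. borel))"
  shows "(\<integral>\<^sup>+u. f u \<partial>mass) =
    (\<Sum>k. ennreal (fact n * w k) * (\<integral>\<^sup>+v. indicator (solid_simplex (r k)) v * f (simplex_point (r k) v) \<partial>L))"
proof -
  interpret L: sigma_finite_measure L by (rule sigma_finite_L)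
  let ?g = "\<lambda>(k, v). ennreal (fact n * w k) * indicator (solid_simplex (r k)) v * f (simplex_point (r k) v)"
  have [measurable]: "?g \<in> borel_measurable (count_space UNIV \<Otimes>\<^sub>M L)"
    by (rule measurable_pair_measure_countable1) auto
  have "(\<integral>\<^sup>+u. f u \<partial>mass) = (\<integral>\<^sup>+p. ?g p \<partial>(count_space UNIV \<Otimes>\<^sub>M L))"
    unfolding mass_def by (simp add: nn_integral_distr nn_integral_density case_prod_beta)
  also have "\<dots> = (\<integral>\<^sup>+k. \<integral>\<^sup>+v. ?g (k, v) \<partial>L \<partial>count_space UNIV)"
    by (rule L.nn_integral_fst[symmetric]) measurable
  also have "\<dots> = (\<Sum>k. \<integral>\<^sup>+v. ?g (k, v) \<partial>L)"
    by (rule nn_integral_count_space_nat)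
  finally show ?thesis by (simp add: mult.assoc nn_integral_cmult)
qed

lemma simplex_slice_measurable [measurable]:
  assumes [measurable]: "A \<in> sets (PiM {..<Suc n} (\<lambda>_. borel))"
  shows "{v \<in> solid_simplex t. simplex_point t v \<in> A} \<in> sets L"
proof -
  have "{v \<in> solid_simplex t. simplex_point t v \<in> A} =
      solid_simplex t \<inter> (simplex_point t -` A \<inter> space L)"
    by (auto simp: solid_simplex_def)
  then show ?thesis by simp
qed

lemma emeasure_mass:
  assumes [measurable]: "A \<in> sets (PiM {..<Suc n} (\<lambda>_. borel))"
  shows "emeasure mass A =
    (\<Sum>k. ennreal (fact n * w k) * emeasure L {v \<in> solid_simplex (r k). simplex_point (r k) v \<in> A})"
proof -
  have eq: "(\<integral>\<^sup>+v. indicator (solid_simplex (r k)) v * indicator A (simplex_point (r k) v) \<partial>L) =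
      emeasure L {v \<in> solid_simplex (r k). simplex_point (r k) v \<in> A}" for k
  proof -
    have "(\<lambda>v. indicator (solid_simplex (r k)) v * indicator A (simplex_point (r k) v) :: ennreal) =
        indicator {v \<in> solid_simplex (r k). simplex_point (r k) v \<in> A}"
      by (auto simp: fun_eq_iff indicator_def)
    then show ?thesis by simp
  qed
  have "emeasure mass A = (\<integral>\<^sup>+u. indicator A u \<partial>mass)" by simp
  also have "\<dots> = (\<Sum>k. ennreal (fact n * w k) *
      (\<integral>\<^sup>+v. indicator (solid_simplex (r k)) v * indicator A (simplex_point (r k) v) \<partial>L))"
    by (rule nn_integral_mass) measurable
  finally show ?thesis by (simp only: eq)
qed

lemma mass_measurable_Collect:
  "Measurable.pred (PiM {..<Suc n} (\<lambda>_. borel)) P \<Longrightarrow> {u \<in> space mass. P u} \<in> sets (PiM {..<Suc n} (\<lambda>_. borel))"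
  unfolding sets_mass[symmetric] by (simp add: pred_def space_mass space_PiM)

lemma simplex_point_in_space: "simplex_point t v \<in> space mass"
  by (auto simp: simplex_point_def space_mass)

text \<open>The density vanishes outside the solid simplices, so an almost sure property only has to
  be checked at the points of the parametrisation.\<close>

lemma AE_massI:
  assumes [measurable]: "Measurable.pred (PiM {..<Suc n} (\<lambda>_. borel)) P"
    and P: "\<And>k v. v \<in> solid_simplex (r k) \<Longrightarrow> P (simplex_point (r k) v)"
  shows "AE u in mass. P u"
proof (rule AE_I[OF order_refl])
  have meas: "{u \<in> space mass. \<not> P u} \<in> sets (PiM {..<Suc n} (\<lambda>_. borel))"
    by (rule mass_measurable_Collect) measurable
  show "emeasure mass {u \<in> space mass. \<not> P u} = 0"
    using P by (subst emeasure_mass[OF meas]) (simp cong: conj_cong)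
  show "{u \<in> space mass. \<not> P u} \<in> sets mass" using meas by simp
qed

lemma emeasure_solid_simplex:
  assumes "0 \<le> t"
  shows "emeasure L (solid_simplex t) = ennreal (t ^ n / fact n)"
  using emeasure_translated_simplex[of "{..<n}" "\<lambda>_. 0" t] n_ge_1 assms
  unfolding solid_simplex_def by (simp add: lessThan_empty_iff Ball_def)

text \<open>The last coordinate takes up the slack, so the values of \<open>pseudo_inv\<close> add
  up to exactly \<open>t\<close>.\<close>

lemma copula_simplex_point:
  assumes "v \<in> solid_simplex t" "0 \<le> t"
  shows "copula (simplex_point t v) = \<psi> t"
proof -
  have "(\<Sum>i<Suc n. pseudo_inv \<psi> (simplex_point t v i)) =
      (\<Sum>i<Suc n. pseudo_inv \<psi> (\<psi> (if i < n then v i else t - (\<Sum>j<n. v j))))"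
    by (intro sum.cong) (auto simp: simplex_point_def)
  also have "\<dots> = ereal t"
    using assms by (subst sum_pseudo_inv_psi) (auto simp: solid_simplex_def)
  finally show ?thesis using assms(2) by (simp only: copula_eq_iff)
qed

lemma simplex_point_in_cube:
  "v \<in> solid_simplex t \<Longrightarrow> simplex_point t v \<in> unit_cube (Suc n)"
  by (auto simp: simplex_point_def unit_cube_def solid_simplex_def less_imp_le[OF psi_pos] intro!: psi_le_1)

lemma mass_sums:
  assumes "\<And>k. 0 \<le> f k" "(\<lambda>k. w k * f k) sums s"
  shows "(\<Sum>k. ennreal (fact n * w k) * ennreal (f k / fact n)) = ennreal s"
proof -
  have "(\<Sum>k. ennreal (fact n * w k) * ennreal (f k / fact n)) = (\<Sum>k. ennreal (w k * f k))"
    using assms(1) less_imp_le[OF w_pos] by (intro suminf_cong) (simp add: ennreal_mult[symmetric])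
  also have "\<dots> = ennreal s"
    using assms less_imp_le[OF w_pos] by (intro suminf_ennreal_eq) auto
  finally show ?thesis .
qed

lemma mixture_sums: "(\<lambda>k. w k * max 0 (r k - z) ^ n) sums \<psi> z"
  unfolding mixture_def by (intro summable_sums summable_mixture) simp

lemma prob_space_mass: "prob_space mass"
proof
  have "emeasure mass (space mass) = (\<Sum>k. ennreal (fact n * w k) * emeasure L (solid_simplex (r k)))"
    using simplex_point_in_space sets.top[of mass] by (subst emeasure_mass) auto
  also have "\<dots> = (\<Sum>k. ennreal (fact n * w k) * ennreal (max 0 (r k - 0) ^ n / fact n))"
    using less_imp_le[OF r_pos] by (intro suminf_cong) (simp add: emeasure_solid_simplex)
  also have "\<dots> = ennreal (\<psi> 0)" by (intro mass_sums mixture_sums) simp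
  finally show "emeasure mass (space mass) = 1" by (simp add: mixture_0)
qed

lemma unit_cube_measurable [measurable]: "unit_cube (Suc n) \<in> sets (PiM {..<Suc n} (\<lambda>_. borel))"
  unfolding unit_cube_def by (intro sets_PiM_I_finite) auto

lemma AE_mass_cube: "AE u in mass. u \<in> unit_cube (Suc n)"
  by (rule AE_massI) (use simplex_point_in_cube in auto)

text \<open>Write \<open>u i = \<psi> (a i)\<close>. Since \<open>\<psi>\<close> decreases, the
  event becomes \<open>a i \<le> v i\<close> for the first \<open>n\<close> coordinates and, for the
  last one, an upper bound on the sum. The preimage is a translated simplex, and the weighted
  volumes add up to the series of \<open>\<psi>\<close> at the sum of the
  \<open>a i\<close>.\<close>

lemma cdf_mass:
  assumes u: "u \<in> unit_cube (Suc n)"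
  shows "measure mass {x \<in> space mass. \<forall>i<Suc n. x i \<le> u i} = copula u"
proof -
  interpret prob_space mass by (rule prob_space_mass)
  have meas: "{x \<in> space mass. \<forall>i<Suc n. x i \<le> u i} \<in> sets (PiM {..<Suc n} (\<lambda>_. borel))"
    by (rule mass_measurable_Collect) measurable
  have bounds: "0 \<le> u i" "u i \<le> 1" if "i < Suc n" for i
    using PiE_mem[OF u[unfolded unit_cube_def], of i] that by simp_all
  show ?thesis
  \<comment> \<open>At a zero coordinate the pseudo-inverse is infinite, so no \<open>a i\<close>
    exists and the copula is 0. The probability is 0 as well, because sample points have positive
    coordinates.\<close>
  proof (cases "\<exists>i<Suc n. u i = 0")
    case True
    then obtain i where i: "i < Suc n" "u i = 0" by blast
    have "\<not> simplex_point t v i \<le> 0" for t v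
      using i psi_pos by (simp add: simplex_point_def not_le)
    then have "\<not> (\<forall>i<Suc n. simplex_point t v i \<le> u i)" for t v
      using i by metis
    then have "AE x in mass. \<not> (\<forall>i<Suc n. x i \<le> u i)"
      by (intro AE_massI) simp_all
    then have "measure mass {x \<in> space mass. \<forall>i<Suc n. x i \<le> u i} = 0"
      by (rule prob_Collect_eq_0[OF meas[folded sets_mass], THEN iffD2])
    moreover have "(\<Sum>i<Suc n. pseudo_inv \<psi> (u i)) = \<infinity>"
      unfolding sum_Pinfty using i by (intro conjI bexI[of _ i]) (simp_all add: pseudo_inv_outside)
    ultimately show ?thesis by (simp add: arch_copula_def psi_ext_def)
  next
    case False
    have "\<exists>z\<ge>0. \<psi> z = u i" if "i < Suc n" for i
    proof -
      have "0 < u i" using bounds(1)[OF that] False that by (auto simp: less_le)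
      then show ?thesis using psi_surj[of "u i"] bounds(2)[OF that] by blast
    qed
    then have "\<forall>i\<in>{..<Suc n}. \<exists>z. 0 \<le> z \<and> \<psi> z = u i" by blast
    from bchoice[OF this] obtain a where "\<forall>i\<in>{..<Suc n}. 0 \<le> a i \<and> \<psi> (a i) = u i" ..
    then have a: "0 \<le> a i" "\<psi> (a i) = u i" if "i < Suc n" for i using that by auto
    have "{v \<in> solid_simplex t. simplex_point t v \<in> {x \<in> space mass. \<forall>i<Suc n. x i \<le> u i}} =
       {v \<in> space L. (\<forall>i\<in>{..<n}. a i \<le> v i) \<and> sum v {..<n} \<le> t - a n}" (is "?A = ?B") for t
    proof (intro set_eqI iffI)
      fix v assume v: "v \<in> ?A"
      then have vs: "v \<in> solid_simplex t" and le: "\<And>i. i < Suc n \<Longrightarrow> simplex_point t v i \<le> \<psi> (a i)"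
        using a by auto
      have "a i \<le> v i" if "i < n" for i
        using le[of i] that vs a(1)[of i] psi_le_iff[of "v i" "a i"]
        by (simp add: simplex_point_def solid_simplex_def)
      moreover have "a n \<le> t - sum v {..<n}"
        using le[of n] vs a(1)[of n] psi_le_iff[of "t - sum v {..<n}" "a n"]
        by (simp add: simplex_point_def solid_simplex_def)
      ultimately show "v \<in> ?B" using vs by (auto simp: solid_simplex_def)
    next
      fix v assume v: "v \<in> ?B"
      then have nonneg: "0 \<le> v i" if "i < n" for i
        using order_trans[of 0 "a i" "v i"] a(1)[of i] that by simp
      have vs: "v \<in> solid_simplex t"
        using v nonneg a(1)[of n] by (simp add: solid_simplex_def)
      have "simplex_point t v i \<le> u i" if "i < Suc n" for i
      proof (cases "i < n")
        case True
        then show ?thesis using v vs a[of i] psi_le_iff[of "v i" "a i"]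
          by (simp add: simplex_point_def solid_simplex_def)
      next
        case False
        then have "i = n" using that by simp
        then show ?thesis using v vs a[of n] psi_le_iff[of "t - sum v {..<n}" "a n"]
          by (simp add: simplex_point_def solid_simplex_def)
      qed
      then show "v \<in> ?A" using vs simplex_point_in_space by auto
    qed
    then have "emeasure L {v \<in> solid_simplex t. simplex_point t v \<in> {x \<in> space mass. \<forall>i<Suc n. x i \<le> u i}} =
        ennreal (max 0 (t - sum a {..<Suc n}) ^ n / fact n)" for t
      using emeasure_translated_simplex[of "{..<n}" a "t - a n"] n_ge_1
      by (simp add: lessThan_empty_iff algebra_simps)
    then have "emeasure mass {x \<in> space mass. \<forall>i<Suc n. x i \<le> u i} =
        (\<Sum>k. ennreal (fact n * w k) * ennreal (max 0 (r k - sum a {..<Suc n}) ^ n / fact n))"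
      by (simp only: emeasure_mass[OF meas])
    also have "\<dots> = ennreal (\<psi> (sum a {..<Suc n}))"
      by (intro mass_sums mixture_sums) simp
    finally have "measure mass {x \<in> space mass. \<forall>i<Suc n. x i \<le> u i} = \<psi> (sum a {..<Suc n})"
      using psi_pos by (simp add: emeasure_eq_measure less_imp_le)
    also have "\<psi> (sum a {..<Suc n}) = copula u"
    proof -
      have "(\<Sum>i<Suc n. pseudo_inv \<psi> (u i)) = (\<Sum>i<Suc n. pseudo_inv \<psi> (\<psi> (a i)))"
        using a(2) by (intro sum.cong) auto
      also have "\<dots> = ereal (sum a {..<Suc n})"
        using a(1) by (intro sum_pseudo_inv_psi) auto
      finally show ?thesis
        using a(1) by (intro copula_eq_iff[THEN iffD2, symmetric] sum_nonneg) auto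
    qed
    finally show ?thesis .
  qed
qed

lemma copula_measure_mass: "copula_measure (Suc n) copula mass"
proof -
  interpret prob_space mass by (rule prob_space_mass)
  have "emeasure mass (unit_cube (Suc n)) = 1"
    using AE_mass_cube by (intro emeasure_eq_1_AE) auto
  then show ?thesis
    unfolding copula_measure_def using cdf_mass prob_space_mass by auto
qed

lemma unit_cube_iff:
  "u \<in> unit_cube m \<longleftrightarrow> u \<in> extensional {..<m} \<and> (\<forall>i<m. 0 \<le> u i \<and> u i \<le> 1)"
  by (auto simp: unit_cube_def PiE_iff)

lemma space_mass_iff: "u \<in> space mass \<longleftrightarrow> u \<in> extensional {..<Suc n}"
  by (auto simp: space_mass PiE_iff)

text \<open>Density of the radii, shifted by \<open>s\<close> and transported through the decreasing
  \<open>\<psi>\<close>. With \<open>s = 0\<close> it gives dense levels, with the offset of a point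
  it gives dense atoms of the conditional law.\<close>

lemma psi_shift_between:
  assumes "0 \<le> s" "0 \<le> a" "a < b" "b \<le> 1"
  shows "\<exists>k. s \<le> r k \<and> a < \<psi> (r k - s) \<and> \<psi> (r k - s) < b"
proof -
  \<comment> \<open>The values at one and two thirds lie strictly between \<open>a\<close> and
    \<open>b\<close>, hence in the range of \<open>\<psi>\<close> even when
    \<open>a = 0\<close>.\<close>
  obtain x where x: "0 \<le> x" "\<psi> x = (a + 2 * b) / 3" using psi_surj[of "(a + 2 * b) / 3"] assms by auto
  obtain y where y: "0 \<le> y" "\<psi> y = (2 * a + b) / 3" using psi_surj[of "(2 * a + b) / 3"] assms by auto
  have "x < y" using psi_less_iff[of y x] x y assms by simp
  then obtain k where k: "s + x < r k" "r k < s + y" using r_dense[of "s + x" "s + y"] assms x by auto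
  then have "\<psi> (r k - s) < \<psi> x" "\<psi> y < \<psi> (r k - s)"
    using x y by (simp_all add: psi_less_iff)
  then show ?thesis using k x y assms by (intro exI[of _ k]) auto
qed

lemma mass_pos:
  assumes "A \<in> sets (PiM {..<Suc n} (\<lambda>_. borel))"
    and "0 < emeasure L {v \<in> solid_simplex (r k). simplex_point (r k) v \<in> A}"
  shows "0 < emeasure mass A"
proof (rule ccontr)
  assume "\<not> 0 < emeasure mass A"
  then have "(\<Sum>k. ennreal (fact n * w k) * emeasure L {v \<in> solid_simplex (r k). simplex_point (r k) v \<in> A}) = 0"
    using emeasure_mass[OF assms(1)] by (simp add: not_gr_zero)
  then have "ennreal (fact n * w k) * emeasure L {v \<in> solid_simplex (r k). simplex_point (r k) v \<in> A} = 0"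
    by (simp add: suminf_eq_zero_iff[OF summableI])
  then show False using assms(2) w_pos[of k] by (simp add: mult_le_0_iff not_le)
qed

section \<open>The law of the first \<open>n\<close> coordinates\<close>

definition marginal :: "(nat \<Rightarrow> real) measure" where
  "marginal = distr mass (PiM {..<n} (\<lambda>_. borel)) (\<lambda>u. restrict u {..<n})"

lemma restrict_measurable [measurable]:
  "(\<lambda>u. restrict u {..<n}) \<in> PiM {..<Suc n} (\<lambda>_. borel) \<rightarrow>\<^sub>M PiM {..<n} (\<lambda>_. borel :: real measure)"
  by (rule measurable_restrict_subset) auto

lemma sets_marginal [measurable_cong, simp]: "sets marginal = sets (PiM {..<n} (\<lambda>_. borel))"
  by (simp add: marginal_def)

lemma space_marginal: "space marginal = PiE {..<n} (\<lambda>_. UNIV)"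
  by (simp add: marginal_def space_PiM)

lemma prob_space_marginal: "prob_space marginal"
  unfolding marginal_def
  by (rule prob_space.prob_space_distr[OF prob_space_mass]) (simp add: measurable_cong_sets[OF sets_mass refl])

lemma measure_marginal:
  assumes "A \<in> sets (PiM {..<n} (\<lambda>_. borel))"
  shows "measure marginal A = measure mass {u \<in> space mass. restrict u {..<n} \<in> A}"
proof -
  have "(\<lambda>u. restrict u {..<n}) \<in> mass \<rightarrow>\<^sub>M PiM {..<n} (\<lambda>_. borel)"
    by (simp add: measurable_cong_sets[OF sets_mass refl])
  then show ?thesis
    unfolding marginal_def using assms
    by (subst measure_distr) (auto intro!: arg_cong[where f = "measure mass"])
qed

text \<open>The last coordinate is almost surely at most 1, so adding this bound to an event about
  the first \<open>n\<close> coordinates does not change its probability, and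
  \<open>cdf_mass\<close> applies.\<close>

lemma copula_measure_marginal: "copula_measure n (\<lambda>x. copula (x(n := 1))) marginal"
proof -
  interpret prob_space mass by (rule prob_space_mass)
  interpret marg: prob_space marginal by (rule prob_space_marginal)
  have cube: "unit_cube n \<in> sets (PiM {..<n} (\<lambda>_. borel :: real measure))"
    unfolding unit_cube_def by (intro sets_PiM_I_finite) auto
  have "AE u in mass. restrict u {..<n} \<in> unit_cube n"
    using AE_mass_cube by (rule eventually_mono) (simp add: unit_cube_iff)
  then have "measure marginal (unit_cube n) = 1"
    unfolding measure_marginal[OF cube] using cube
    by (subst prob_Collect_eq_1) (auto intro!: mass_measurable_Collect)
  then have "emeasure marginal (unit_cube n) = 1"
    by (simp add: marg.emeasure_eq_measure)
  moreover have "measure marginal {x \<in> space marginal. \<forall>i<n. x i \<le> u i} = copula (u(n := 1))"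
    if u: "u \<in> unit_cube n" for u
  proof -
    have u1: "u(n := 1) \<in> unit_cube (Suc n)"
      using u by (simp add: unit_cube_iff extensional_def less_Suc_eq)
    have meas: "{x \<in> space marginal. \<forall>i<n. x i \<le> u i} \<in> sets (PiM {..<n} (\<lambda>_. borel))"
    proof -
      have "{x \<in> space (PiM {..<n} (\<lambda>_. borel)). \<forall>i<n. x i \<le> u i} \<in> sets (PiM {..<n} (\<lambda>_. borel))"
        by measurable
      then show ?thesis by (simp add: space_marginal space_PiM)
    qed
    have "measure marginal {x \<in> space marginal. \<forall>i<n. x i \<le> u i}
        = measure mass {x \<in> space mass. \<forall>i<n. x i \<le> u i}"
      unfolding measure_marginal[OF meas]
      by (rule arg_cong[where f = "measure mass"]) (auto simp: space_marginal)
    also have "\<dots> = measure mass {x \<in> space mass. \<forall>i<Suc n. x i \<le> (u(n := 1)) i}"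
    proof (rule finite_measure_eq_AE)
      show "AE x in mass. x \<in> {x \<in> space mass. \<forall>i<n. x i \<le> u i} \<longleftrightarrow>
          x \<in> {x \<in> space mass. \<forall>i<Suc n. x i \<le> (u(n := 1)) i}"
        using AE_mass_cube by (rule eventually_mono) (simp add: unit_cube_iff less_Suc_eq)
      show "{x \<in> space mass. \<forall>i<n. x i \<le> u i} \<in> sets mass"
        unfolding sets_mass by (rule mass_measurable_Collect) measurable
      have "{x \<in> space mass. \<forall>i<Suc n. x i \<le> c i} \<in> sets mass" for c
        unfolding sets_mass by (rule mass_measurable_Collect) measurable
      then show "{x \<in> space mass. \<forall>i<Suc n. x i \<le> (u(n := 1)) i} \<in> sets mass" .
    qed
    also have "\<dots> = copula (u(n := 1))" by (rule cdf_mass[OF u1])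
    finally show ?thesis .
  qed
  ultimately show ?thesis
    unfolding copula_measure_def using prob_space_marginal by simp
qed

text \<open>On a solid simplex \<open>simplex_point\<close> is injective because
  \<open>\<psi>\<close> is. So the preimage of a point has at most one element, which is a Lebesgue
  null set in dimension \<open>n \<ge> 1\<close>.\<close>

lemma mass_no_atoms: "emeasure mass {x} = 0"
proof (cases "{x} \<in> sets (PiM {..<Suc n} (\<lambda>_. borel :: real measure))")
  case True
  interpret product_sigma_finite "\<lambda>_::nat. lborel :: real measure" by standard
  have "emeasure L {v \<in> solid_simplex (r k). simplex_point (r k) v \<in> {x}} = 0" for k
  proof (cases "{v \<in> solid_simplex (r k). simplex_point (r k) v \<in> {x}} = {}")
    case True
    then show ?thesis by (simp only: emeasure_empty)
  next
    case False
    then obtain v where v: "v \<in> solid_simplex (r k)" "simplex_point (r k) v = x" by blast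
    have "v' = v" if v': "v' \<in> solid_simplex (r k)" "simplex_point (r k) v' = x" for v'
    proof (rule PiE_ext[of v' "{..<n}" "\<lambda>_. UNIV" v])
      fix i assume "i \<in> {..<n}"
      then have "\<psi> (v' i) = \<psi> (v i)"
        using fun_cong[OF trans[OF v'(2) v(2)[symmetric]], of i] by (simp add: simplex_point_def)
      then show "v' i = v i" using v v' \<open>i \<in> {..<n}\<close> by (simp add: psi_eq_iff solid_simplex_def)
    qed (use v v' in \<open>auto simp: solid_simplex_def space_PiM\<close>)
    then have "{v \<in> solid_simplex (r k). simplex_point (r k) v \<in> {x}} \<subseteq> {v}" by blast
    moreover have "v \<in> PiE {..<n} (\<lambda>i. {v i})"
      using v(1) by (simp add: solid_simplex_def space_PiM PiE_iff)
    ultimately have sub: "{v \<in> solid_simplex (r k). simplex_point (r k) v \<in> {x}} \<subseteq> PiE {..<n} (\<lambda>i. {v i})"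
      by blast
    have "emeasure L (PiE {..<n} (\<lambda>i. {v i})) = 0"
      using n_ge_1 by (subst emeasure_PiM) (auto simp: power_0_left)
    then show ?thesis
      using emeasure_mono[OF sub, of L] sets_PiM_I_finite[of "{..<n}" "\<lambda>i. {v i}" "\<lambda>_. lborel"] by simp
  qed
  then show ?thesis by (subst emeasure_mass[OF True]) simp
next
  \<comment> \<open>A set outside the sigma-algebra has \<open>emeasure\<close> 0 by convention;
    this covers points outside the space.\<close>
  case False
  then show ?thesis by (intro emeasure_notin_sets) simp
qed

section \<open>Level sets, singularity and the Kendall distribution\<close>

definition levels :: "real set" where "levels = (\<lambda>k. \<psi> (r k)) ` UNIV"

lemma countable_levels: "countable levels"
  unfolding levels_def by simp

lemma levels_measurable [measurable]: "levels \<in> sets borel"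
  by (rule sets.countable[rotated, OF countable_levels]) simp

lemma levels_subset: "levels \<subseteq> {0<..<1}"
  using psi_pos psi_less_1 r_pos by (auto simp: levels_def)

lemma levels_dense: "0 \<le> a \<Longrightarrow> a < b \<Longrightarrow> b \<le> 1 \<Longrightarrow> \<exists>q\<in>levels. a < q \<and> q < b"
  using psi_shift_between[of 0 a b] by (auto simp: levels_def)

lemma AE_mass_levels: "AE u in mass. copula u \<in> levels"
proof (rule AE_massI)
  show "Measurable.pred (PiM {..<Suc n} (\<lambda>_. borel)) (\<lambda>u. copula u \<in> levels)" by measurable
  show "copula (simplex_point (r k) v) \<in> levels" if "v \<in> solid_simplex (r k)" for k v
    using copula_simplex_point[OF that] r_pos[of k] by (simp add: levels_def)
qed

lemma sets_lebesgue_d: "sets (lebesgue_d m) = sets (PiM {..<m} (\<lambda>_. borel))"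
  unfolding lebesgue_d_def by (intro sets_PiM_cong) simp_all

text \<open>Fubini in the last coordinate: once the others are fixed, at most one \<open>y\<close>
  puts the point on the level.\<close>

lemma lebesgue_level_null:
  assumes "0 \<le> z"
  shows "emeasure (lebesgue_d (Suc n)) {u \<in> space mass. copula u = \<psi> z} = 0"
proof -
  interpret product_sigma_finite "\<lambda>_::nat. lborel :: real measure" by standard
  let ?A = "{u \<in> space mass. copula u = \<psi> z}"
  have A: "?A \<in> sets (PiM {..<Suc n} (\<lambda>_. borel))" by (rule mass_measurable_Collect) measurable
  then have A' [measurable]: "?A \<in> sets (PiM (insert n {..<n}) (\<lambda>_. lborel))"
    by (simp add: lessThan_Suc[symmetric] cong: sets_PiM_cong)
  have "emeasure (lebesgue_d (Suc n)) ?A = (\<integral>\<^sup>+u. indicator ?A u \<partial>PiM (insert n {..<n}) (\<lambda>_. lborel))"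
    using A' by (simp add: lebesgue_d_def lessThan_Suc)
  also have "\<dots> = (\<integral>\<^sup>+x. \<integral>\<^sup>+y. indicator ?A (x(n := y)) \<partial>lborel \<partial>L)"
    by (rule product_nn_integral_insert) simp_all
  also have "\<dots> = (\<integral>\<^sup>+x. 0 \<partial>L)"
  proof (rule nn_integral_cong)
    fix x :: "nat \<Rightarrow> real"
    \<comment> \<open>If the sum is infinite, \<open>real_of_ereal\<close> turns it into 0 and
      \<open>c\<close> has no meaning; but then no \<open>y\<close> lies in the section, so the
      bound by a singleton still holds.\<close>
    define c where "c = z - real_of_ereal (\<Sum>i<n. pseudo_inv \<psi> (x i))"
    have "y = \<psi> c" if "x(n := y) \<in> ?A" for y
    proof -
      have "(\<Sum>i<Suc n. pseudo_inv \<psi> ((x(n := y)) i)) = ereal z"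
        using that copula_eq_iff[OF assms] by blast
      then have "(\<Sum>i<n. pseudo_inv \<psi> (x i)) + pseudo_inv \<psi> y = ereal z" by simp
      then have "pseudo_inv \<psi> y = ereal c"
        using sum_pseudo_inv_nonneg[of x "{..<n}"] pseudo_inv_nonneg[of y]
        by (cases "\<Sum>i<n. pseudo_inv \<psi> (x i)"; cases "pseudo_inv \<psi> y") (auto simp: c_def)
      then show ?thesis by (simp add: pseudo_inv_eq_ereal_iff)
    qed
    note level = this
    have "indicator ?A (x(n := y)) \<le> (indicator {\<psi> c} y :: ennreal)" for y
    proof (cases "x(n := y) \<in> ?A")
      case True
      then show ?thesis using level[OF True] indicator_le_1[of ?A "x(n := y)"] by simp
    next
      case False
      then show ?thesis unfolding indicator_simps(2)[OF False] by simp
    qed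
    then have "(\<integral>\<^sup>+y. indicator ?A (x(n := y)) \<partial>lborel) \<le> (\<integral>\<^sup>+y. indicator {\<psi> c} y \<partial>lborel)"
      by (intro nn_integral_mono)
    then show "(\<integral>\<^sup>+y. indicator ?A (x(n := y)) \<partial>lborel) = 0" by simp
  qed
  finally show ?thesis by simp
qed

lemma singular_mass: "singular_wrt mass (lebesgue_d (Suc n))"
  unfolding singular_wrt_def
proof (intro bexI conjI)
  let ?A = "{u \<in> space mass. copula u \<in> levels}"
  show A: "?A \<in> sets mass"
    unfolding sets_mass by (rule mass_measurable_Collect) measurable
  have "?A = (\<Union>k. {u \<in> space mass. copula u = \<psi> (r k)})" by (auto simp: levels_def)
  moreover have "{u \<in> space mass. copula u = \<psi> (r k)} \<in> null_sets (lebesgue_d (Suc n))" for k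
  proof (rule null_setsI)
    show "emeasure (lebesgue_d (Suc n)) {u \<in> space mass. copula u = \<psi> (r k)} = 0"
      using lebesgue_level_null[of "r k"] r_pos[of k] by simp
    have "{u \<in> space mass. copula u = \<psi> (r k)} \<in> sets (PiM {..<Suc n} (\<lambda>_. borel))"
      by (rule mass_measurable_Collect) measurable
    then show "{u \<in> space mass. copula u = \<psi> (r k)} \<in> sets (lebesgue_d (Suc n))"
      by (simp only: sets_lebesgue_d)
  qed
  ultimately have "?A \<in> null_sets (lebesgue_d (Suc n))" by (simp only: null_sets_UN)
  then show "emeasure (lebesgue_d (Suc n)) ?A = 0" by (rule null_setsD1)
  have "space mass - ?A = {u \<in> space mass. copula u \<notin> levels}" by auto
  moreover have "emeasure mass {u \<in> space mass. copula u \<notin> levels} = 0"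
    using AE_mass_levels by (intro emeasure_eq_0_AE) simp
  ultimately show "emeasure mass (space mass - ?A) = 0" by simp
qed

text \<open>The level \<open>\<psi> (r k)\<close> contains the whole simplex of radius
  \<open>r k\<close>, whose projection has positive volume; values outside \<open>levels\<close> are
  almost surely not attained.\<close>

lemma level_set_pos_iff: "0 < measure mass (level_set (Suc n) copula t) \<longleftrightarrow> t \<in> levels"
proof -
  interpret prob_space mass by (rule prob_space_mass)
  let ?A = "level_set (Suc n) copula t"
  have eq: "?A = {u \<in> space mass. u \<in> unit_cube (Suc n) \<and> copula u = t}"
    by (auto simp: level_set_def unit_cube_iff space_mass_iff)
  have A: "?A \<in> sets (PiM {..<Suc n} (\<lambda>_. borel))"
    unfolding eq by (rule mass_measurable_Collect) measurable
  show ?thesis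
  proof
    assume "t \<in> levels"
    then obtain k where t: "t = \<psi> (r k)" by (auto simp: levels_def)
    have r0: "0 \<le> r k" using r_pos[of k] by simp
    have "{v \<in> solid_simplex (r k). simplex_point (r k) v \<in> ?A} = solid_simplex (r k)"
      using copula_simplex_point[OF _ r0] simplex_point_in_cube by (auto simp: level_set_def t)
    then have "0 < emeasure L {v \<in> solid_simplex (r k). simplex_point (r k) v \<in> ?A}"
      using r_pos[of k] by (simp add: emeasure_solid_simplex[OF r0])
    from mass_pos[OF A this] show "0 < measure mass ?A"
      by (simp add: emeasure_eq_measure)
  next
    assume pos: "0 < measure mass ?A"
    show "t \<in> levels"
    proof (rule ccontr)
      assume "t \<notin> levels"
      then have "AE u in mass. \<not> (u \<in> unit_cube (Suc n) \<and> copula u = t)"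
        using AE_mass_levels by (rule_tac eventually_mono) auto
      then have "emeasure mass ?A = 0" unfolding eq by (rule emeasure_eq_0_AE)
      then have "measure mass ?A = 0" by (simp add: measure_def)
      then show False using pos by simp
    qed
  qed
qed

lemma copula_nonneg: "0 \<le> copula u"
  using psi_pos by (simp add: arch_copula_def psi_ext_def less_imp_le)

lemma kendall_step: "strict_step_df (kendall_df mass copula)"
proof -
  interpret prob_space mass by (rule prob_space_mass)
  let ?N = "distr mass borel copula"
  have copula [measurable]: "copula \<in> borel_measurable mass"
    by (simp add: measurable_cong_sets[OF sets_mass refl])
  interpret N: prob_space ?N by (rule prob_space_distr) fact
  have eq: "kendall_df mass copula = (\<lambda>y. measure ?N {0..y})"
    using copula_nonneg by (auto simp: fun_eq_iff kendall_df_def measure_distr intro!: arg_cong[where f = "measure mass"])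
  show ?thesis
    unfolding eq
  proof (rule strict_step_df_discrete[where S = levels])
    show "finite_measure ?N" by unfold_locales
    show "levels \<subseteq> {0..1}" using levels_subset by auto
    have "AE y in ?N. y \<in> levels" using AE_mass_levels by (simp add: AE_distr_iff)
    then have "emeasure ?N {y \<in> space ?N. y \<notin> levels} = 0" by (intro emeasure_eq_0_AE) simp
    moreover have "{y \<in> space ?N. y \<notin> levels} = - levels" by auto
    ultimately show "emeasure ?N (- levels) = 0" by simp
    fix a b :: real assume "0 \<le> a" "a < b" "b \<le> 1"
    then obtain q where q: "q \<in> levels" "a < q" "q < b" using levels_dense by blast
    have "measure mass (level_set (Suc n) copula q) \<le> measure mass (copula -` {q} \<inter> space mass)"
      using measurable_sets[OF copula, of "{q}"]
      by (intro finite_measure_mono) (auto simp: level_set_def unit_cube_iff space_mass_iff)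
    then have "0 < measure ?N {q}"
      using q level_set_pos_iff[of q] by (simp add: measure_distr)
    then show "\<exists>s>a. s \<le> b \<and> 0 < measure ?N {s}" using q by (intro exI[of _ q]) simp
  qed (use countable_levels in simp_all)
qed

subsection \<open>Full support\<close>

text \<open>\<open>\<psi>\<close> maps the positive half-line onto the open unit interval, so the
  end points 0 and 1 can only be approximated. A strictly positive \<open>z\<close> leaves room for
  perturbations within the simplex.\<close>

lemma psi_dense_open:
  assumes "0 \<le> x" "x \<le> 1" "0 < (e::real)"
  shows "\<exists>z>0. \<bar>\<psi> z - x\<bar> < e"
proof -
  have "\<exists>y. 0 < y \<and> y < 1 \<and> \<bar>y - x\<bar> < e"
  proof (cases "x = 0")
    case True
    then show ?thesis using assms by (intro exI[of _ "min e 1 / 2"]) (auto simp: min_def)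
  next
    case False
    define h where "h = min e x / 2"
    have "0 < h" "h < x" "h < e" using False assms by (auto simp: h_def min_def)
    then show ?thesis using assms by (intro exI[of _ "x - h"]) auto
  qed
  then obtain y where y: "0 < y" "y < 1" "\<bar>y - x\<bar> < e" by blast
  then obtain z where z: "0 \<le> z" "\<psi> z = y" using psi_surj[of y] by auto
  then have "z \<noteq> 0" using y mixture_0 by auto
  then show ?thesis using z y by (intro exI[of _ z]) simp
qed

lemma emeasure_cube_pos:
  fixes z :: "nat \<Rightarrow> real"
  assumes "0 < h"
  shows "0 < emeasure L (PiE {..<n} (\<lambda>i. {z i - h<..<z i + h}))"
proof -
  interpret product_sigma_finite "\<lambda>_::nat. lborel :: real measure" by standard
  have "emeasure L (PiE {..<n} (\<lambda>i. {z i - h<..<z i + h})) = (\<Prod>i<n. ennreal (2 * h))"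
    using assms by (subst emeasure_PiM) (auto intro!: prod.cong)
  then show ?thesis using assms by (simp add: ennreal_power)
qed

lemma box_measurable:
  "{y \<in> space mass. \<forall>i<Suc n. \<bar>y i - x i\<bar> < (e::real)} \<in> sets (PiM {..<Suc n} (\<lambda>_. borel))"
  by (rule mass_measurable_Collect) measurable

text \<open>The first \<open>n\<close> coordinates may range over a small cube, but the last one is
  then forced by the radius. A radius slightly above the sum of the \<open>z i\<close> forces it
  close to \<open>z n\<close>, and a single such radius already gives positive mass.\<close>

lemma box_mass_pos:
  assumes x: "x \<in> unit_cube (Suc n)" and e: "0 < e"
  shows "0 < emeasure mass {y \<in> space mass. \<forall>i<Suc n. \<bar>y i - x i\<bar> < e}" (is "0 < emeasure mass ?A")
proof -
  have "\<exists>z>0. \<bar>\<psi> z - x i\<bar> < e" if "i < Suc n" for i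
    using x that e by (intro psi_dense_open) (simp_all add: unit_cube_iff)
  then have "\<forall>i\<in>{..<Suc n}. \<exists>z. 0 < z \<and> \<bar>\<psi> z - x i\<bar> < e" by blast
  from bchoice[OF this] obtain z where "\<forall>i\<in>{..<Suc n}. 0 < z i \<and> \<bar>\<psi> (z i) - x i\<bar> < e" ..
  then have z: "0 < z i" "\<bar>\<psi> (z i) - x i\<bar> < e" if "i < Suc n" for i using that by simp_all
  have "\<exists>h>0. \<forall>y. \<bar>y - z i\<bar> < h \<longrightarrow> 0 < y \<and> \<bar>\<psi> y - x i\<bar> < e" if i: "i < Suc n" for i
  proof -
    have "open ({0<..} \<inter> {y. \<bar>\<psi> y - x i\<bar> < e})"
      by (intro open_Int open_Collect_less continuous_intros psi_continuous)
    then obtain h where "h > 0" "ball (z i) h \<subseteq> {0<..} \<inter> {y. \<bar>\<psi> y - x i\<bar> < e}"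
      using z[OF i] openE[of "{0<..} \<inter> {y. \<bar>\<psi> y - x i\<bar> < e}" "z i"] by auto
    then show ?thesis by (intro exI[of _ h]) (auto simp: subset_iff dist_real_def abs_minus_commute)
  qed
  then have "\<forall>i\<in>{..<Suc n}. \<exists>h. 0 < h \<and> (\<forall>y. \<bar>y - z i\<bar> < h \<longrightarrow> 0 < y \<and> \<bar>\<psi> y - x i\<bar> < e)" by blast
  from bchoice[OF this] obtain h where
    h: "\<forall>i\<in>{..<Suc n}. 0 < h i \<and> (\<forall>y. \<bar>y - z i\<bar> < h i \<longrightarrow> 0 < y \<and> \<bar>\<psi> y - x i\<bar> < e)" ..
  define \<delta> where "\<delta> = Min (h ` {..<Suc n})"
  have \<delta>: "0 < \<delta>" using h unfolding \<delta>_def by (subst Min_gr_iff) auto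
  have near: "0 < y" "\<bar>\<psi> y - x i\<bar> < e" if "i < Suc n" "\<bar>y - z i\<bar> < \<delta>" for i y
  proof -
    have "\<delta> \<le> h i" unfolding \<delta>_def using that(1) by (intro Min_le) auto
    then show "0 < y" "\<bar>\<psi> y - x i\<bar> < e" using h that by simp_all
  qed
  \<comment> \<open>The \<open>n\<close> deviations of size \<open>\<eta>\<close> add up to
    \<open>\<delta> / 2\<close>; the other half is left for the excess of the radius over the sum of
    the \<open>z i\<close>.\<close>
  define \<eta> where "\<eta> = \<delta> / (2 * real n)"
  have n0: "0 < real n" using n_ge_1 by simp
  have \<eta>: "0 < \<eta>" "\<eta> < \<delta>" "real n * \<eta> = \<delta> / 2"
    using \<delta> n0 n_ge_1 by (auto simp: \<eta>_def field_simps)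
  have s: "0 \<le> (\<Sum>i<Suc n. z i)" using z(1) by (intro sum_nonneg) (simp add: less_imp_le)
  obtain k where k: "(\<Sum>i<Suc n. z i) < r k" "r k < (\<Sum>i<Suc n. z i) + \<delta> / 2"
    using r_dense[OF s, of "(\<Sum>i<Suc n. z i) + \<delta> / 2"] \<delta> by auto
  have sub: "PiE {..<n} (\<lambda>i. {z i - \<eta><..<z i + \<eta>}) \<subseteq> {v \<in> solid_simplex (r k). simplex_point (r k) v \<in> ?A}"
  proof
    fix v assume v: "v \<in> PiE {..<n} (\<lambda>i. {z i - \<eta><..<z i + \<eta>})"
    have close: "\<bar>v i - z i\<bar> < \<eta>" if "i < n" for i
      using PiE_mem[OF v, of i] that by (simp add: abs_less_iff)
    have "\<bar>(\<Sum>i<n. v i) - (\<Sum>i<n. z i)\<bar> \<le> (\<Sum>i<n. \<bar>v i - z i\<bar>)"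
      unfolding sum_subtractf[symmetric] by (rule sum_abs)
    also have "\<dots> \<le> (\<Sum>i<n. \<eta>)" using close by (intro sum_mono less_imp_le) simp
    also have "\<dots> = \<delta> / 2" using \<eta>(3) by simp
    finally have "\<bar>(\<Sum>i<n. v i) - (\<Sum>i<n. z i)\<bar> \<le> \<delta> / 2" .
    then have last: "\<bar>(r k - (\<Sum>i<n. v i)) - z n\<bar> < \<delta>" using k[unfolded sum.lessThan_Suc] \<delta> by linarith
    have vpos: "0 < v i" "\<bar>\<psi> (v i) - x i\<bar> < e" if "i < n" for i
      using near[of i "v i"] close[OF that] that \<eta>(2) by simp_all
    have lpos: "0 < r k - (\<Sum>i<n. v i)" "\<bar>\<psi> (r k - (\<Sum>i<n. v i)) - x n\<bar> < e"
      using near[OF _ last] by simp_all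
    have "v \<in> solid_simplex (r k)"
      using v vpos(1) lpos(1) by (simp add: solid_simplex_def space_PiM PiE_iff less_imp_le)
    moreover have "\<bar>simplex_point (r k) v i - x i\<bar> < e" if "i < Suc n" for i
      using vpos(2) lpos(2) that by (cases "i < n") (simp_all add: simplex_point_def less_Suc_eq)
    ultimately show "v \<in> {v \<in> solid_simplex (r k). simplex_point (r k) v \<in> ?A}"
      using simplex_point_in_space by simp
  qed
  have "0 < emeasure L {v \<in> solid_simplex (r k). simplex_point (r k) v \<in> ?A}"
    using emeasure_cube_pos[OF \<eta>(1), of z] emeasure_mono[OF sub simplex_slice_measurable[OF box_measurable]] by (rule less_le_trans)
  then show ?thesis by (rule mass_pos[OF box_measurable])
qed

lemma support_mass: "support_d (Suc n) mass = unit_cube (Suc n)"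
proof (intro set_eqI iffI)
  fix x assume "x \<in> unit_cube (Suc n)"
  then show "x \<in> support_d (Suc n) mass"
    using box_mass_pos[of x] by (simp add: support_d_def space_mass_iff unit_cube_iff)
next
  fix x assume x: "x \<in> support_d (Suc n) mass"
  show "x \<in> unit_cube (Suc n)"
  proof (rule ccontr)
    assume "x \<notin> unit_cube (Suc n)"
    then obtain i where i: "i < Suc n" "x i < 0 \<or> 1 < x i"
      using x by (auto simp: unit_cube_iff support_d_def space_mass_iff not_le)
    \<comment> \<open>The distance from \<open>x i\<close> to the unit interval, so that the open
      box of this size misses the cube.\<close>
    define e where "e = (if x i < 0 then - x i else x i - 1)"
    have e: "0 < e" using i by (auto simp: e_def)
    have "AE y in mass. \<not> (\<forall>i<Suc n. \<bar>y i - x i\<bar> < e)"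
      using AE_mass_cube
    proof (rule eventually_mono)
      fix y assume "y \<in> unit_cube (Suc n)"
      then have "0 \<le> y i" "y i \<le> 1" using i by (simp_all add: unit_cube_iff)
      then have "\<not> \<bar>y i - x i\<bar> < e" using i(2) by (auto simp: e_def)
      then show "\<not> (\<forall>i<Suc n. \<bar>y i - x i\<bar> < e)" using i(1) by blast
    qed
    then have "emeasure mass {y \<in> space mass. \<forall>i<Suc n. \<bar>y i - x i\<bar> < e} = 0"
      by (rule emeasure_eq_0_AE)
    moreover have "0 < emeasure mass {y \<in> space mass. \<forall>i<Suc n. \<bar>y i - x i\<bar> < e}"
      using x e unfolding support_d_def by blast
    ultimately show False by simp
  qed
qed

subsection \<open>The conditional distribution of the last coordinate\<close>

text \<open>\<open>real_of_ereal\<close> sends an infinite sum to 0. This default makes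
  \<open>kernel x\<close> a probability measure with dense atoms for every \<open>x\<close>, with no
  exceptional set.\<close>

definition offset :: "(nat \<Rightarrow> real) \<Rightarrow> real" where
  "offset x = real_of_ereal (\<Sum>i<n. pseudo_inv \<psi> (x i))"

lemma offset_nonneg: "0 \<le> offset x"
  unfolding offset_def by (intro real_of_ereal_pos sum_pseudo_inv_nonneg)

lemma offset_measurable [measurable]: "offset \<in> borel_measurable (PiM {..<n} (\<lambda>_. borel))"
  unfolding offset_def[abs_def] by measurable

text \<open>The normalising constant of the conditional law: the indicator selects the radii with
  \<open>s \<le> r k\<close>.\<close>

definition weight_above :: "real \<Rightarrow> real" where
  "weight_above s = (\<Sum>k. w k * indicator {..r k} s)"

lemma summable_weight_above: "summable (\<lambda>k. w k * indicator {..r k} s)"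
proof (rule summable_comparison_test'[OF summable_weights])
  fix k
  have "1 \<le> (1 + r k) ^ n" using r_pos[of k] by (intro one_le_power) simp
  then have "w k * indicator {..r k} s \<le> w k * (1 + r k) ^ n"
    using w_pos[of k] by (intro mult_left_mono) (simp_all add: indicator_def)
  then show "norm (w k * indicator {..r k} s) \<le> w k * (1 + r k) ^ n"
    using w_pos[of k] by simp
qed

lemma weight_above_pos: "0 \<le> s \<Longrightarrow> 0 < weight_above s"
proof -
  assume "0 \<le> s"
  then obtain k where k: "s < r k" using r_dense[of s "s + 1"] by auto
  show ?thesis unfolding weight_above_def
    by (rule suminf_pos2[OF summable_weight_above, where i = k])
      (use k w_pos less_imp_le[OF w_pos] in \<open>simp_all add: indicator_def\<close>)
qed

lemma weight_above_measurable [measurable]: "weight_above \<in> borel_measurable borel"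
  unfolding weight_above_def[abs_def] by measurable

text \<open>Bayes' rule for the radius: given the first \<open>n\<close> coordinates the density of \<open>r k\<close> is
  proportional to \<open>w k\<close> on all \<open>r k \<ge> offset x\<close>, since \<open>w k * r k ^ n\<close> is the prior probability
  and the volume of the simplex is proportional to \<open>r k ^ n\<close>.\<close>

definition kernel :: "(nat \<Rightarrow> real) \<Rightarrow> real measure" where
  "kernel x = distr
     (density (count_space UNIV)
       (\<lambda>k. ennreal (w k * indicator {..r k} (offset x) / weight_above (offset x))))
     borel (\<lambda>k. \<psi> (r k - offset x))"

lemma sets_kernel [simp, measurable_cong]: "sets (kernel x) = sets borel"
  by (simp add: kernel_def)

lemma emeasure_kernel:
  assumes "B \<in> sets borel"
  shows "emeasure (kernel x) B =
    (\<Sum>k. ennreal (w k * indicator {..r k} (offset x) / weight_above (offset x)) *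
      indicator B (\<psi> (r k - offset x)))"
proof -
  let ?g = "\<lambda>k. ennreal (w k * indicator {..r k} (offset x) / weight_above (offset x))"
  have "emeasure (kernel x) B = emeasure (density (count_space UNIV) ?g) ((\<lambda>k. \<psi> (r k - offset x)) -` B)"
    unfolding kernel_def using assms by (subst emeasure_distr) simp_all
  also have "\<dots> = (\<integral>\<^sup>+k. ?g k * indicator B (\<psi> (r k - offset x)) \<partial>count_space UNIV)"
    by (subst emeasure_density) (simp_all add: indicator_vimage[unfolded comp_def])
  finally show ?thesis by (simp only: nn_integral_count_space_nat)
qed

lemma prob_space_kernel: "prob_space (kernel x)"
proof
  have W: "0 < weight_above (offset x)" by (intro weight_above_pos offset_nonneg)
  have "(\<lambda>k. w k * indicator {..r k} (offset x) / weight_above (offset x)) sums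
      (weight_above (offset x) / weight_above (offset x))"
    unfolding weight_above_def by (intro sums_divide summable_sums summable_weight_above)
  then have "(\<lambda>k. w k * indicator {..r k} (offset x) / weight_above (offset x)) sums 1"
    using W by simp
  then have "emeasure (kernel x) UNIV = ennreal 1"
    using W less_imp_le[OF w_pos] by (simp add: emeasure_kernel suminf_ennreal_eq sums_unique[symmetric])
  then show "emeasure (kernel x) (space (kernel x)) = 1"
    by (simp add: kernel_def)
qed

lemma kernel_atom_pos:
  assumes "offset x \<le> r k"
  shows "0 < measure (kernel x) {\<psi> (r k - offset x)}"
proof -
  interpret prob_space "kernel x" by (rule prob_space_kernel)
  let ?f = "\<lambda>j. ennreal (w j * indicator {..r j} (offset x) / weight_above (offset x)) *
      indicator {\<psi> (r k - offset x)} (\<psi> (r j - offset x))"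
  have pos: "0 < ?f k"
    using assms w_pos[of k] weight_above_pos[OF offset_nonneg, of x] by simp
  have "(\<Sum>j. ?f j) \<noteq> 0"
  proof
    assume "(\<Sum>j. ?f j) = 0"
    then have "?f k = 0"
      by (subst (asm) suminf_eq_zero_iff[OF summableI]) (simp, blast)
    with pos show False by (simp only: less_irrefl)
  qed
  then have "emeasure (kernel x) {\<psi> (r k - offset x)} \<noteq> 0"
    unfolding emeasure_kernel[OF borel_singleton[OF sets.empty_sets]] .
  then show ?thesis by (simp add: emeasure_eq_measure less_le)
qed

text \<open>Radii below the offset have weight 0, so only values of \<open>\<psi>\<close> at
  nonnegative arguments carry mass; \<open>psi_shift_between\<close> with shift
  \<open>offset x\<close> makes these atoms dense.\<close>

lemma kernel_step: "strict_step_df (\<lambda>y. measure (kernel x) {0..y})"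
proof -
  interpret prob_space "kernel x" by (rule prob_space_kernel)
  define S where "S = (\<lambda>k. \<psi> (r k - offset x)) ` {k. offset x \<le> r k}"
  have S: "countable S" unfolding S_def by simp
  have S_borel: "S \<in> sets borel" by (rule sets.countable[rotated, OF S]) simp
  show ?thesis
  proof (rule strict_step_df_discrete[OF _ sets_kernel S])
    show "finite_measure (kernel x)" by unfold_locales
    show "S \<subseteq> {0..1}" unfolding S_def using psi_le_1 less_imp_le[OF psi_pos] by auto
    have "ennreal (w k * indicator {..r k} (offset x) / weight_above (offset x)) *
        indicator (- S) (\<psi> (r k - offset x)) = 0" for k
      by (cases "offset x \<le> r k") (simp_all add: S_def)
    moreover have "- S \<in> sets borel" using S_borel by simp
    ultimately show "emeasure (kernel x) (- S) = 0"
      by (simp only: emeasure_kernel suminf_zero)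
    fix a b :: real assume ab: "0 \<le> a" "a < b" "b \<le> 1"
    obtain k where "offset x \<le> r k" "a < \<psi> (r k - offset x)" "\<psi> (r k - offset x) < b"
      using psi_shift_between[OF offset_nonneg ab] by blast
    then show "\<exists>s>a. s \<le> b \<and> 0 < measure (kernel x) {s}"
      using kernel_atom_pos[of x k] by (intro exI[of _ "\<psi> (r k - offset x)"]) simp
  qed
qed

lemma emeasure_kernel_measurable [measurable]:
  assumes "B \<in> sets borel"
  shows "(\<lambda>x. emeasure (kernel x) B) \<in> borel_measurable (PiM {..<n} (\<lambda>_. borel))"
  unfolding emeasure_kernel[OF assms] using assms by measurable

definition front :: "(nat \<Rightarrow> real) \<Rightarrow> nat \<Rightarrow> real" where
  "front v = (\<lambda>i\<in>{..<n}. \<psi> (v i))"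

lemma restrict_simplex_point: "restrict (simplex_point t v) {..<n} = front v"
  by (auto simp: front_def simplex_point_def fun_eq_iff)

lemma front_measurable [measurable]: "front \<in> L \<rightarrow>\<^sub>M PiM {..<n} (\<lambda>_. borel)"
  unfolding front_def[abs_def] by measurable

lemma offset_front:
  assumes "\<And>i. i < n \<Longrightarrow> 0 \<le> v i"
  shows "offset (front v) = (\<Sum>i<n. v i)"
proof -
  have "(\<Sum>i<n. pseudo_inv \<psi> (front v i)) = (\<Sum>i<n. pseudo_inv \<psi> (\<psi> (v i)))"
    by (intro sum.cong) (simp_all add: front_def)
  also have "\<dots> = ereal (\<Sum>i<n. v i)"
    using assms by (intro sum_pseudo_inv_psi) simp
  finally show ?thesis by (simp add: offset_def)
qed

text \<open>With the sum under the integral, the radii can be compared at a fixed \<open>v\<close>,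
  that is, conditionally on the first \<open>n\<close> coordinates.\<close>

lemma nn_integral_mass_sum_inside:
  assumes [measurable]: "f \<in> borel_measurable (PiM {..<Suc n} (\<lambda>_. borel))"
  shows "(\<integral>\<^sup>+u. f u \<partial>mass) =
    (\<integral>\<^sup>+v. (\<Sum>k. ennreal (fact n * w k) * (indicator (solid_simplex (r k)) v * f (simplex_point (r k) v))) \<partial>L)"
  unfolding nn_integral_mass[OF assms]
  by (subst nn_integral_suminf) (simp_all add: nn_integral_cmult)

text \<open>The kernel value does not depend on \<open>k\<close>, so the weights on the left add up
  to \<open>fact n * weight_above s\<close>, which cancels the denominator in \<open>kernel\<close>.
  If a coordinate of \<open>v\<close> is negative, both sides are 0.\<close>

lemma disintegration_pointwise:
  assumes v: "v \<in> space L" and B: "B \<in> sets borel"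
  shows "(\<Sum>k. ennreal (fact n * w k) * (indicator (solid_simplex (r k)) v * emeasure (kernel (front v)) B)) =
    (\<Sum>k. ennreal (fact n * w k) * (indicator (solid_simplex (r k)) v * indicator B (simplex_point (r k) v n)))"
proof (cases "\<forall>i<n. 0 \<le> v i")
  case False
  then have "indicator (solid_simplex t) v = (0::ennreal)" for t
    by (simp add: solid_simplex_def)
  then show ?thesis by simp
next
  case True
  define s where "s = (\<Sum>i<n. v i)"
  have off: "offset (front v) = s" using offset_front True by (simp add: s_def)
  have s0: "0 \<le> s" using offset_nonneg[of "front v"] by (simp add: off)
  have ind: "indicator (solid_simplex t) v = ennreal (indicator {..t} s)" for t
    using True v by (simp add: solid_simplex_def s_def indicator_def)
  have last: "simplex_point t v n = \<psi> (t - s)" for t by (simp add: simplex_point_def s_def)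
  have W: "0 < weight_above s" by (rule weight_above_pos[OF s0])
  have "(\<Sum>k. ennreal (fact n * w k) * (indicator (solid_simplex (r k)) v * emeasure (kernel (front v)) B)) =
      (\<Sum>k. ennreal (fact n * w k) * ennreal (indicator {..r k} s)) * emeasure (kernel (front v)) B"
    unfolding ind by (simp add: mult.assoc[symmetric])
  also have "(\<Sum>k. ennreal (fact n * w k) * ennreal (indicator {..r k} s)) =
      (\<Sum>k. ennreal (fact n * (w k * indicator {..r k} s)))"
    using less_imp_le[OF w_pos] by (intro suminf_cong) (simp add: ennreal_mult[symmetric] mult.assoc)
  also have "\<dots> = ennreal (fact n * weight_above s)"
    unfolding weight_above_def using less_imp_le[OF w_pos]
    by (intro suminf_ennreal_eq sums_mult summable_sums summable_weight_above) simp
  also have "ennreal (fact n * weight_above s) * emeasure (kernel (front v)) B =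
      (\<Sum>k. ennreal (fact n * weight_above s) *
        (ennreal (w k * indicator {..r k} s / weight_above s) * indicator B (\<psi> (r k - s))))"
    unfolding emeasure_kernel[OF B] off by simp
  also have "\<dots> = (\<Sum>k. ennreal (fact n * w k) * (indicator (solid_simplex (r k)) v * indicator B (simplex_point (r k) v n)))"
  proof (rule suminf_cong)
    fix k
    have "ennreal (fact n * weight_above s) * ennreal (w k * indicator {..r k} s / weight_above s) =
        ennreal (fact n * w k) * ennreal (indicator {..r k} s)"
      using W less_imp_le[OF w_pos[of k]] by (simp add: ennreal_mult[symmetric])
    then show "ennreal (fact n * weight_above s) *
        (ennreal (w k * indicator {..r k} s / weight_above s) * indicator B (\<psi> (r k - s))) =
      ennreal (fact n * w k) * (indicator (solid_simplex (r k)) v * indicator B (simplex_point (r k) v n))"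
      unfolding ind last by (simp only: mult.assoc[symmetric])
  qed
  finally show ?thesis .
qed

text \<open>The first \<open>n\<close> coordinates are \<open>front v\<close> whatever the radius,
  so the indicator of \<open>A\<close> is a factor common to all terms of the sum, and what remains
  is the pointwise identity.\<close>

lemma disintegration:
  assumes A: "A \<in> sets (PiM {..<n} (\<lambda>_. borel))" and B: "B \<in> sets borel"
  shows "(\<integral>\<^sup>+x. indicator A x * emeasure (kernel x) B \<partial>marginal) =
    emeasure mass {u \<in> space mass. restrict u {..<n} \<in> A \<and> u n \<in> B}" (is "_ = emeasure mass ?E")
proof -
  note A[measurable] B[measurable]
  have E: "?E \<in> sets (PiM {..<Suc n} (\<lambda>_. borel))"
    by (rule mass_measurable_Collect) measurable
  have ind_E: "indicator ?E (simplex_point t v) = (indicator A (front v) * indicator B (simplex_point t v n) :: ennreal)" for t v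
    using simplex_point_in_space[of t v] by (simp add: indicator_def restrict_simplex_point)
  have "(\<integral>\<^sup>+x. indicator A x * emeasure (kernel x) B \<partial>marginal) =
      (\<integral>\<^sup>+u. indicator A (restrict u {..<n}) * emeasure (kernel (restrict u {..<n})) B \<partial>mass)"
    unfolding marginal_def by (rule nn_integral_distr) (simp_all add: measurable_cong_sets[OF sets_mass refl])
  also have "\<dots> = (\<integral>\<^sup>+v. (\<Sum>k. ennreal (fact n * w k) * (indicator (solid_simplex (r k)) v *
      (indicator A (front v) * emeasure (kernel (front v)) B))) \<partial>L)"
    by (subst nn_integral_mass_sum_inside) (simp_all add: restrict_simplex_point)
  also have "\<dots> = (\<integral>\<^sup>+v. (\<Sum>k. ennreal (fact n * w k) * (indicator (solid_simplex (r k)) v *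
      indicator ?E (simplex_point (r k) v))) \<partial>L)"
  proof (rule nn_integral_cong)
    fix v assume v: "v \<in> space L"
    have "(\<Sum>k. ennreal (fact n * w k) * (indicator (solid_simplex (r k)) v *
        (indicator A (front v) * emeasure (kernel (front v)) B))) =
      indicator A (front v) * (\<Sum>k. ennreal (fact n * w k) * (indicator (solid_simplex (r k)) v * emeasure (kernel (front v)) B))"
      unfolding ennreal_suminf_cmult[symmetric] by (simp only: mult_ac)
    also have "\<dots> = indicator A (front v) *
        (\<Sum>k. ennreal (fact n * w k) * (indicator (solid_simplex (r k)) v * indicator B (simplex_point (r k) v n)))"
      by (simp only: disintegration_pointwise[OF v B])
    also have "\<dots> = (\<Sum>k. ennreal (fact n * w k) * (indicator (solid_simplex (r k)) v * indicator ?E (simplex_point (r k) v)))"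
      unfolding ennreal_suminf_cmult[symmetric] ind_E by (simp only: mult_ac)
    finally show "(\<Sum>k. ennreal (fact n * w k) * (indicator (solid_simplex (r k)) v *
        (indicator A (front v) * emeasure (kernel (front v)) B))) =
      (\<Sum>k. ennreal (fact n * w k) * (indicator (solid_simplex (r k)) v * indicator ?E (simplex_point (r k) v)))" .
  qed
  also have "\<dots> = (\<integral>\<^sup>+u. indicator ?E u \<partial>mass)"
    using E by (intro nn_integral_mass_sum_inside[symmetric]) simp
  finally show ?thesis using E by simp
qed

text \<open>Uniqueness of regular conditional distributions: for a fixed Borel set, \<open>K\<close>
  and \<open>kernel\<close> have equal integrals over every \<open>A\<close> and thus agree almost
  everywhere. The step property passes from \<open>kernel\<close> to any version.\<close>

lemma markov_kernel_of_step:
  assumes K: "markov_kernel_of (Suc n) mass marginal K"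
  shows "AE x in marginal. strict_step_df (\<lambda>y. measure (K x) {0..y})"
proof -
  interpret prob_space mass by (rule prob_space_mass)
  interpret marg: prob_space marginal by (rule prob_space_marginal)
  have prob: "prob_space (K x)" "sets (K x) = sets borel" if "x \<in> space marginal" for x
    using K that by (simp_all add: markov_kernel_of_def)
  have AE_eq: "AE x in marginal. measure (K x) B = measure (kernel x) B" if B: "B \<in> sets borel" for B
  proof (rule density_unique_real)
    have "(\<lambda>x. measure (K x) B) \<in> borel_measurable marginal"
      using K B by (simp add: markov_kernel_of_def)
    then show "integrable marginal (\<lambda>x. measure (K x) B)"
      by (intro marg.integrable_const_bound[where B = 1])
        (auto intro!: AE_I2 prob_space.prob_le_1 prob)
    have kernel_meas: "(\<lambda>x. measure (kernel x) B) \<in> borel_measurable marginal"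
      unfolding measure_def using emeasure_kernel_measurable[OF B]
      by (simp add: measurable_cong_sets[OF sets_marginal refl])
    then show "integrable marginal (\<lambda>x. measure (kernel x) B)"
      by (intro marg.integrable_const_bound[where B = 1])
        (auto intro!: AE_I2 prob_space.prob_le_1 prob_space_kernel)
    fix A assume A: "A \<in> sets marginal"
    have "(LINT x:A|marginal. measure (K x) B) =
        measure mass {u \<in> space mass. restrict u {..<n} \<in> A \<and> u n \<in> B}"
      using K A B by (simp add: markov_kernel_of_def)
    also have "\<dots> = enn2real (\<integral>\<^sup>+x. indicator A x * emeasure (kernel x) B \<partial>marginal)"
      using disintegration[of A B] A B by (simp add: measure_def)
    also have "\<dots> = enn2real (\<integral>\<^sup>+x. ennreal (indicator A x * measure (kernel x) B) \<partial>marginal)"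
      by (simp add: finite_measure.emeasure_eq_measure[OF prob_space.finite_measure[OF prob_space_kernel]]
            ennreal_mult ennreal_indicator)
    also have "\<dots> = (LINT x:A|marginal. measure (kernel x) B)"
      unfolding set_lebesgue_integral_def using A kernel_meas
      by (subst integral_eq_nn_integral) (simp_all add: sets_marginal[symmetric] del: sets_marginal)
    finally show "(LINT x:A|marginal. measure (K x) B) = (LINT x:A|marginal. measure (kernel x) B)" .
  qed
  \<comment> \<open>The null set found so far depends on the Borel set; the rational half-lines are
    countably many, so one null set serves all of them.\<close>
  have "AE x in marginal. \<forall>q\<in>\<rat>. measure (K x) {..q} = measure (kernel x) {..q}"
    by (subst AE_ball_countable) (use AE_eq in \<open>simp_all add: countable_rat\<close>)
  with AE_space show ?thesis
  proof eventually_elim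
    case (elim x)
    have "K x = kernel x"
    proof (rule real_distribution_eq_rational)
      interpret Kx: prob_space "K x" by (rule prob[OF elim(1)])
      show "real_distribution (K x)"
        by unfold_locales (simp_all add: prob[OF elim(1)])
      interpret kx: prob_space "kernel x" by (rule prob_space_kernel)
      show "real_distribution (kernel x)"
        by unfold_locales simp_all
    qed (use elim in blast)
    then show ?case using kernel_step by simp
  qed
qed

end

subsection \<open>Existence\<close>

text \<open>The positive rationals with rapidly decaying weights give an unnormalised mixture.
  Dividing the weights fixes the value at 0, and rescaling the radii moves the point of half the
  initial value to 1.\<close>

lemma ex_archimedean_mixture:
  assumes n: "2 \<le> n"
  shows "\<exists>r w. archimedean_mixture n r w"
proof -
  define q :: "nat \<Rightarrow> real" where "q = from_nat_into (\<rat> \<inter> {0<..})"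
  have "(1::real) \<in> \<rat> \<inter> {0<..}" by simp
  then have range_q: "range q = \<rat> \<inter> {0<..}"
    unfolding q_def by (intro range_from_nat_into countable_Int1 countable_rat) blast
  then have q_pos: "0 < q k" for k by blast
  have q_dense: "\<exists>k. a < q k \<and> q k < b" if ab: "0 \<le> a" "a < b" for a b
  proof -
    obtain x where x: "x \<in> \<rat>" "a < x" "x < b" using Rats_dense_in_real[OF ab(2)] by blast
    then have "x \<in> range q" unfolding range_q using ab(1) by simp
    then show ?thesis using x by blast
  qed
  \<comment> \<open>Chosen so that the series in \<open>summable_weights\<close> is exactly
    geometric.\<close>
  define v where "v k = (1 / 2) ^ k / (1 + q k) ^ n" for k
  have v_pos: "0 < v k" for k using q_pos[of k] by (simp add: v_def)
  have summable_v: "summable (\<lambda>k. v k * (1 + q k) ^ n)"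
  proof -
    have "v k * (1 + q k) ^ n = (1 / 2) ^ k" for k
      using q_pos[of k] by (simp add: v_def)
    then show ?thesis by (simp add: summable_geometric)
  qed
  interpret base: truncated_power_mixture n q v
    by unfold_locales (fact n q_pos v_pos q_dense summable_v)+
  define f where "f = base.mixture n"
  define c where "c = f 0"
  have c: "0 < c" unfolding c_def f_def using n by (intro base.mixture_pos) simp_all
  have "eventually (\<lambda>z. f z < c / 2) at_top"
    unfolding f_def using order_tendstoD(2)[OF base.mixture_tendsto_0[of n], of "c / 2"] n c by simp
  then have "eventually (\<lambda>z. f z < c / 2 \<and> 0 \<le> z) at_top"
    by (intro eventually_conj eventually_ge_at_top)
  from eventually_happens[OF this] obtain b where b: "f b < c / 2" "0 \<le> b" by auto
  have "continuous_on {0..b} f" unfolding f_def using n by (intro base.continuous_mixture) simp_all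
  then obtain h where h: "0 \<le> h" "f h = c / 2"
    using IVT2'[of f b "c / 2" 0] b c by (auto simp: c_def)
  have "h \<noteq> 0" using h c by (auto simp: c_def)
  with h have h_pos: "0 < h" by simp
  define r where "r k = q k / h" for k
  \<comment> \<open>The factor \<open>h ^ n\<close> undoes the division of the radii by
    \<open>h\<close> inside the power, so the new mixture is \<open>f (h * z) / c\<close>.\<close>
  define w where "w k = v k * h ^ n / c" for k
  have r_pos: "0 < r k" and w_pos: "0 < w k" for k
    using q_pos v_pos h_pos c by (simp_all add: r_def w_def)
  have summable_w: "summable (\<lambda>k. w k * (1 + r k) ^ n)"
  proof (rule summable_comparison_test'[OF summable_mult2[OF summable_v, of "(1 + 1 / h) ^ n * h ^ n / c"]])
    fix k
    have "1 + r k \<le> (1 + q k) * (1 + 1 / h)"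
      using q_pos[of k] h_pos by (simp add: r_def field_simps)
    then have "(1 + r k) ^ n \<le> ((1 + q k) * (1 + 1 / h)) ^ n"
      using r_pos[of k] by (intro power_mono) simp_all
    then have "w k * (1 + r k) ^ n \<le> w k * ((1 + q k) * (1 + 1 / h)) ^ n"
      using w_pos[of k] by simp
    also have "\<dots> = v k * (1 + q k) ^ n * ((1 + 1 / h) ^ n * h ^ n / c)"
      unfolding w_def by (simp add: power_mult_distrib)
    finally show "norm (w k * (1 + r k) ^ n) \<le> v k * (1 + q k) ^ n * ((1 + 1 / h) ^ n * h ^ n / c)"
      using w_pos[of k] r_pos[of k] by simp
  qed
  interpret scaled: truncated_power_mixture n r w
  proof
    show "\<exists>k. a < r k \<and> r k < b" if ab: "0 \<le> a" "a < b" for a b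
    proof -
      obtain k where "a * h < q k" "q k < b * h" using q_dense[of "a * h" "b * h"] ab h_pos by auto
      then show ?thesis using h_pos by (intro exI[of _ k]) (simp add: r_def field_simps)
    qed
  qed (fact n r_pos w_pos summable_w)+
  have scaled_eq: "scaled.mixture n z = f (h * z) / c" for z
  proof -
    have "w k * max 0 (r k - z) ^ n = v k * max 0 (q k - h * z) ^ n / c" for k
    proof -
      have "h * max 0 (r k - z) = max 0 (q k - h * z)"
        using h_pos by (simp add: r_def max_mult_distrib_left right_diff_distrib)
      then have "h ^ n * max 0 (r k - z) ^ n = max 0 (q k - h * z) ^ n"
        by (simp add: power_mult_distrib[symmetric])
      then show ?thesis by (simp add: w_def mult.assoc)
    qed
    then show ?thesis
      unfolding scaled.mixture_def f_def base.mixture_def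
      using base.summable_mixture[of n "h * z"] by (simp add: suminf_divide)
  qed
  have "archimedean_mixture n r w"
    by unfold_locales (use h c in \<open>simp_all add: scaled_eq c_def\<close>)
  then show ?thesis by blast
qed

theorem theorem6p2:
  fixes d :: nat
  assumes "d \<ge> 3"
  shows "\<exists>\<psi>. archimedean_generator d \<psi> \<and>
    (\<exists>M M1. copula_measure d (arch_copula d \<psi>) M \<and>
       copula_measure (d - 1) (\<lambda>x. arch_copula d \<psi> (x(d - 1 := 1))) M1 \<and>
       singular_wrt M (lebesgue_d d) \<and>
       (\<forall>x\<in>space M. emeasure M {x} = 0) \<and>
       support_d d M = unit_cube d \<and>
       (\<forall>K. markov_kernel_of d M M1 K \<longrightarrow>
          (AE x in M1. strict_step_df (\<lambda>y. measure (K x) {0..y}))) \<and>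
       (\<exists>Q. countable Q \<and> Q \<subseteq> {0<..<1} \<and>
          (\<forall>a b. 0 < a \<and> a < b \<and> b < 1 \<longrightarrow> (\<exists>q\<in>Q. a < q \<and> q < b)) \<and>
          (\<forall>t\<in>{0..1}. measure M (level_set d (arch_copula d \<psi>) t) > 0 \<longleftrightarrow> t \<in> Q)) \<and>
       strict_step_df (kendall_df M (arch_copula d \<psi>)))"
proof -
  obtain n where d: "d = Suc n" and n: "2 \<le> n"
    using assms by (cases d) simp_all
  obtain r w where "archimedean_mixture n r w" using ex_archimedean_mixture[OF n] by blast
  then interpret archimedean_mixture n r w .
  have n': "Suc n - 1 = n" by simp
  have Q: "\<exists>Q. countable Q \<and> Q \<subseteq> {0<..<1} \<and>
      (\<forall>a b. 0 < a \<and> a < b \<and> b < 1 \<longrightarrow> (\<exists>q\<in>Q. a < q \<and> q < b)) \<and>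
      (\<forall>t\<in>{0..1}. measure mass (level_set (Suc n) copula t) > 0 \<longleftrightarrow> t \<in> Q)"
    using countable_levels levels_subset levels_dense level_set_pos_iff
    by (intro exI[of _ levels]) (simp add: less_imp_le)
  show ?thesis
    unfolding d n'
    by (rule exI[of _ \<psi>], rule conjI[OF archimedean_generator_mixture[OF mixture_0 mixture_1]],
        rule exI[of _ mass], rule exI[of _ marginal],
        intro conjI ballI allI impI copula_measure_mass copula_measure_marginal singular_mass
          mass_no_atoms support_mass markov_kernel_of_step Q kendall_step)
qed

end
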